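(* Let $\mathbf{D}\subset\mathbb{R}^2$ be a simply connected bounded domain whose boundary contains a non-trivial segment $[z,w]$, $z\neq w$, such that $\partial\mathbf{D}\cap(z,w)=[z,w]$, where $(z,w)$ denotes the infinite line through $z$ and $w$. Let $\mathtt{S}$ be the reflection through the line $(z,w)$. Let $\omega\in L^\infty(\mathbb{R};L^\infty_c(\mathbf{D}))$ be a global weak solution of the Euler equations in $\mathbf{D}$. Then the function $$\omega^{\#}(t,x)=\begin{cases}\omega(t,x),&x\in\mathbf{D},\\-\omega(t,\mathtt{S}x),&x\in\mathtt{S}(\mathbf{D}),\end{cases}$$ belongs to $L^\infty(\mathbb{R};L^\infty_c(\mathbf{D}^\star))$ and is a global in time weak solution of the Euler equations in $\mathbf{D}^\star=\mathrm{Int}\big(\overline{\mathbf{D}}\cup\overline{\mathtt{S}(\mathbf{D})}\big)$. In particular, if $\omega$ is a time periodic vortex patch, then $\omega^{\#}$ is a time periodic counter-rotating pair of patches.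
   Context: Euler equations in a bounded domain $U$: $\partial_t\omega+u\cdot\nabla\omega=0$, $u=\nabla^\perp\psi$, $\nabla^\perp=(-\partial_y,\partial_x)$, where $\Delta\psi=\omega$ in $U$ and $\psi=0$ on $\partial U$ (that is, $u=\nabla^\perp\Delta_U^{-1}\omega$ with $\Delta_U$ the Dirichlet Laplacian). $L^\infty_c(U)$ denotes the bounded functions on $U$ with compact support in $U$. $\mathrm{Int}$ denotes the topological interior. A vortex patch is a solution of the form $c\,\mathbf{1}_{D_t}$ with $c$ constant and $D_t$ a bounded set; a counter-rotating pair of patches is a solution of the form $c\mathbf{1}_{D_t}-c\mathbf{1}_{D_t'}$.
   Formalization: The domain D is additionally assumed to equal the interior of its closure (no slits); without this the claim fails, e.g. for a half disc minus a slit, where D* fills in the slit and a stationary patch in D does not extend to a solution in D*. *)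

theory Defs
  imports "HOL-Analysis.Analysis"
begin

type_synonym plane = "real^2"

section \<open>Test functions\<close>

primrec C_k :: "nat \<Rightarrow> ('a::euclidean_space \<Rightarrow> real) \<Rightarrow> bool" where
  "C_k 0 f \<longleftrightarrow> continuous_on UNIV f"
| "C_k (Suc k) f \<longleftrightarrow> (\<forall>x. f differentiable (at x)) \<and>
     (\<forall>b\<in>Basis. C_k k (\<lambda>x. frechet_derivative f (at x) b))"

definition test_functions :: "'a::euclidean_space set \<Rightarrow> ('a \<Rightarrow> real) set" where
  "test_functions U = {\<phi>. (\<forall>k. C_k k \<phi>) \<and>
     compact (closure {x. \<phi> x \<noteq> 0}) \<and> closure {x. \<phi> x \<noteq> 0} \<subseteq> U}"

definition grad :: "(plane \<Rightarrow> real) \<Rightarrow> plane \<Rightarrow> plane" where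
  "grad f x = (\<chi> i. frechet_derivative f (at x) (axis i 1))"

definition perp :: "plane \<Rightarrow> plane" where
  "perp v = vector [- (v $ 2), v $ 1]"

section \<open>The Dirichlet Laplacian\<close>

text \<open>\<open>H10 U \<psi> g\<close>: the function \<open>\<psi>\<close> lies in the Sobolev space $H^1_0(U)$, the closure of the
  test functions in $H^1(U)$, and \<open>g\<close> is its weak gradient. Only the values in \<open>U\<close> matter, up to
  null sets.\<close>

definition H10 :: "plane set \<Rightarrow> (plane \<Rightarrow> real) \<Rightarrow> (plane \<Rightarrow> plane) \<Rightarrow> bool" where
  "H10 U \<psi> g \<longleftrightarrow>
     \<psi> \<in> borel_measurable (lebesgue_on U) \<and> g \<in> borel_measurable (lebesgue_on U) \<and>
     (\<exists>\<phi>. (\<forall>n. \<phi> n \<in> test_functions U) \<and>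
        (\<lambda>n::nat. \<integral>\<^sup>+x. ennreal ((\<phi> n x - \<psi> x)\<^sup>2) \<partial>lebesgue_on U) \<longlonglongrightarrow> 0 \<and>
        (\<lambda>n. \<integral>\<^sup>+x. ennreal ((norm (grad (\<phi> n) x - g x))\<^sup>2) \<partial>lebesgue_on U) \<longlonglongrightarrow> 0)"

text \<open>\<open>dirichlet_solution U f \<psi> g\<close>: \<open>\<psi>\<close> is $\Delta_U^{-1} f$, that is $\Delta \psi = f$ in the sense of
  distributions in \<open>U\<close> and $\psi = 0$ on the boundary in the sense of $H^1_0$; \<open>g\<close> is the weak gradient
  of \<open>\<psi>\<close>. For bounded open \<open>U\<close> and bounded \<open>f\<close>, such \<open>\<psi>\<close> and \<open>g\<close> exist and are unique up to null
  sets.\<close>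

definition dirichlet_solution ::
    "plane set \<Rightarrow> (plane \<Rightarrow> real) \<Rightarrow> (plane \<Rightarrow> real) \<Rightarrow> (plane \<Rightarrow> plane) \<Rightarrow> bool" where
  "dirichlet_solution U f \<psi> g \<longleftrightarrow> H10 U \<psi> g \<and>
     (\<forall>\<phi>\<in>test_functions U.
        (LINT x|lebesgue_on U. g x \<bullet> grad \<phi> x) = - (LINT x|lebesgue_on U. f x * \<phi> x))"

definition velocity_of :: "plane set \<Rightarrow> (plane \<Rightarrow> real) \<Rightarrow> (plane \<Rightarrow> plane) \<Rightarrow> bool" where
  "velocity_of U f v \<longleftrightarrow>
     (\<exists>\<psi> g. dirichlet_solution U f \<psi> g \<and> (AE x in lebesgue_on U. v x = perp (g x)))"

section \<open>Weak solutions of the Euler equations\<close>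

definition Linf_c :: "plane set \<Rightarrow> (plane \<Rightarrow> real) set" where
  "Linf_c U = {f. f \<in> borel_measurable (lebesgue_on U) \<and>
     (\<exists>M. AE x in lebesgue_on U. \<bar>f x\<bar> \<le> M) \<and>
     (\<exists>K. compact K \<and> K \<subseteq> U \<and> (AE x in lebesgue_on U. x \<notin> K \<longrightarrow> f x = 0))}"

text \<open>The space $L^\infty(\mathbb{R}; L^\infty_c(U))$. Measurability is that of the function of $(t,x)$,
  since a moving patch is not strongly measurable as a map into $L^\infty$. The compact support
  may depend on the time.\<close>

definition Linf_Linf_c :: "plane set \<Rightarrow> (real \<Rightarrow> plane \<Rightarrow> real) set" where
  "Linf_Linf_c U = {\<omega>.
     (\<lambda>(t, x). \<omega> t x) \<in> borel_measurable (lebesgue_on (UNIV \<times> U)) \<and>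
     (AE t in lebesgue. \<omega> t \<in> Linf_c U) \<and>
     (\<exists>M. AE t in lebesgue. AE x in lebesgue_on U. \<bar>\<omega> t x\<bar> \<le> M)}"

definition global_weak_euler :: "plane set \<Rightarrow> (real \<Rightarrow> plane \<Rightarrow> real) \<Rightarrow> bool" where
  "global_weak_euler U \<omega> \<longleftrightarrow> \<omega> \<in> Linf_Linf_c U \<and>
     (\<exists>u. (\<lambda>(t, x). u t x) \<in> borel_measurable (lebesgue_on (UNIV \<times> U)) \<and>
        (AE t in lebesgue. velocity_of U (\<omega> t) (u t)) \<and>
        (\<forall>\<phi>\<in>test_functions (UNIV \<times> U).
           (LINT (t, x)|lebesgue_on (UNIV \<times> U).
              \<omega> t x * (deriv (\<lambda>s. \<phi> (s, x)) t + u t x \<bullet> grad (\<lambda>y. \<phi> (t, y)) x)) = 0))"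

definition vortex_patch :: "plane set \<Rightarrow> (real \<Rightarrow> plane \<Rightarrow> real) \<Rightarrow> bool" where
  "vortex_patch U \<omega> \<longleftrightarrow> global_weak_euler U \<omega> \<and>
     (\<exists>c A. (\<forall>t. bounded (A t) \<and> A t \<subseteq> U) \<and>
        (AE t in lebesgue. AE x in lebesgue_on U. \<omega> t x = c * indicator (A t) x))"

definition counter_rotating_pair :: "plane set \<Rightarrow> (real \<Rightarrow> plane \<Rightarrow> real) \<Rightarrow> bool" where
  "counter_rotating_pair U \<omega> \<longleftrightarrow> global_weak_euler U \<omega> \<and>
     (\<exists>c A A'. (\<forall>t. bounded (A t) \<and> A t \<subseteq> U \<and> bounded (A' t) \<and> A' t \<subseteq> U) \<and>
        (AE t in lebesgue. AE x in lebesgue_on U.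
           \<omega> t x = c * indicator (A t) x - c * indicator (A' t) x))"

definition time_periodic :: "plane set \<Rightarrow> (real \<Rightarrow> plane \<Rightarrow> real) \<Rightarrow> bool" where
  "time_periodic U \<omega> \<longleftrightarrow>
     (\<exists>T>0. AE t in lebesgue. AE x in lebesgue_on U. \<omega> (t + T) x = \<omega> t x)"

section \<open>Reflection through a line\<close>

definition reflect :: "plane \<Rightarrow> plane \<Rightarrow> plane \<Rightarrow> plane" where
  "reflect z w x =
     2 *\<^sub>R (z + (((x - z) \<bullet> (w - z)) / ((w - z) \<bullet> (w - z))) *\<^sub>R (w - z)) - x"

definition doubled_domain :: "plane set \<Rightarrow> plane \<Rightarrow> plane \<Rightarrow> plane set" where
  "doubled_domain D z w = interior (closure D \<union> closure (reflect z w ` D))"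

text \<open>Outside \<open>D\<close> and its mirror image the value 0 is a convention.\<close>

definition odd_extension ::
    "plane set \<Rightarrow> plane \<Rightarrow> plane \<Rightarrow> (real \<Rightarrow> plane \<Rightarrow> real) \<Rightarrow> real \<Rightarrow> plane \<Rightarrow> real" where
  "odd_extension D z w \<omega> t x =
     (if x \<in> D then \<omega> t x
      else if x \<in> reflect z w ` D then - \<omega> t (reflect z w x)
      else 0)"

end

theory Submission
  imports Defs
begin

text \<open>The domain \<open>D\<close> lies strictly on one side of the line, because a point of \<open>D\<close> on the line
  would force a boundary point on the line outside the segment. Hence the doubled domain is \<open>D\<close>, its
  mirror image and a null set. Under the reflection \<open>S\<close>, the odd extensions of vorticity, stream
  function and its gradient turn an integral over the doubled domain against a test function \<open>\<phi>\<close>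
  into one over \<open>D\<close> against \<open>\<Phi> = \<phi> - \<phi> \<circ> S\<close>. This \<open>\<Phi>\<close> is not compactly supported in \<open>D\<close>, but it
  is bounded by a multiple of the distance to the line, so cutting it off in a strip of width
  \<open>1 / m\<close> keeps its gradient bounded, and dominated convergence gives the identity for \<open>\<Phi>\<close>. The same
  argument handles the Poisson equation on the plane and the transport equation on space-time. The
  domination there needs the velocity to be jointly integrable in time and space, which follows from
  the energy estimate for the Dirichlet problem.\<close>

section \<open>Smooth functions and the cut-off profile\<close>

text \<open>Both equations have one form: the integral of \<open>D \<eta> (F) + f * \<eta>\<close>
  vanishes for every test function \<open>\<eta>\<close>. In the plane \<open>F\<close> is the
  gradient of the stream function and \<open>f\<close> the vorticity; in space-time
  \<open>F = (\<omega>, \<omega> u)\<close>, \<open>f = 0\<close>, and the mirror has normal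
  \<open>(0, n)\<close>. Hence reflections are studied in a general Euclidean space. With
  \<open>R\<close> the linear part of the mirror, both fields become \<open>- R F\<close> on the
  mirrored side, but for different reasons: the gradient of an odd function does so by the chain
  rule, whereas the velocity becomes \<open>R u\<close>, since a reflection anticommutes with the
  quarter turn \<open>perp\<close>, and the sign comes from the vorticity. The obstacle is that
  \<open>F\<close> is merely integrable up to the line and has no usable trace there, so the cut-off
  may cost only a bounded factor. The profile \<open>exp (- 1 / s)\<close> never reaches 1; what
  counts is that its derivative, multiplied by the distance to the line, stays bounded and tends to
  0 at each point. The condition \<open>interior (closure D) = D\<close> keeps the closure in the
  doubled domain from filling slits or punctures of \<open>D\<close>.\<close>

lemma C_k_SucI:
  assumes "\<And>x. (f has_derivative f' x) (at x)"
    and "\<And>b. b \<in> Basis \<Longrightarrow> C_k k (\<lambda>x. f' x b)"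
  shows "C_k (Suc k) f"
proof -
  have "frechet_derivative f (at x) = f' x" for x
    using frechet_derivative_at[OF assms(1)] by simp
  then show ?thesis using assms by (auto simp: differentiable_def)
qed

lemma C_k_has_derivative:
  "C_k (Suc k) f \<Longrightarrow> (f has_derivative frechet_derivative f (at x)) (at x)"
  by (simp add: frechet_derivative_works[symmetric])

lemma C_k_SucD: "C_k (Suc k) f \<Longrightarrow> C_k k f"
proof (induction k arbitrary: f)
  case 0
  then show ?case
    by (auto intro!: continuous_at_imp_continuous_on differentiable_imp_continuous_within)
next
  case (Suc k)
  then show ?case by (metis C_k.simps(2))
qed

lemma C_k_const: "C_k k (\<lambda>x. c)"
proof (induction k arbitrary: c)
  case (Suc k)
  show ?case by (rule C_k_SucI[where f' = "\<lambda>x v. 0"]) (auto intro: Suc)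
qed auto

lemma C_k_add: "C_k k f \<Longrightarrow> C_k k g \<Longrightarrow> C_k k (\<lambda>x. f x + g x)"
proof (induction k arbitrary: f g)
  case 0
  then show ?case by (auto intro: continuous_on_add)
next
  case (Suc k)
  note d = Suc.prems(1)[THEN C_k_has_derivative] Suc.prems(2)[THEN C_k_has_derivative]
  show ?case
    by (rule C_k_SucI[OF has_derivative_add[OF d]]) (use Suc in auto)
qed

lemma C_k_mult: "C_k k f \<Longrightarrow> C_k k g \<Longrightarrow> C_k k (\<lambda>x. f x * g x)"
proof (induction k arbitrary: f g)
  case 0
  then show ?case by (auto intro: continuous_on_mult)
next
  case (Suc k)
  note d = Suc.prems(1)[THEN C_k_has_derivative] Suc.prems(2)[THEN C_k_has_derivative]
  show ?case
    by (rule C_k_SucI[OF has_derivative_mult[OF d]])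
      (use Suc.prems C_k_SucD[OF Suc.prems(1)] C_k_SucD[OF Suc.prems(2)] in
        \<open>auto intro!: C_k_add Suc.IH\<close>)
qed

lemma C_k_sum: "(\<And>i. i \<in> I \<Longrightarrow> C_k k (f i)) \<Longrightarrow> C_k k (\<lambda>x. \<Sum>i\<in>I. f i x)"
  by (induction I rule: infinite_finite_induct) (auto intro: C_k_add C_k_const)

lemma C_k_diff: "C_k k f \<Longrightarrow> C_k k g \<Longrightarrow> C_k k (\<lambda>x. f x - g x)"
  using C_k_add[of k f "\<lambda>x. (- 1) * g x"] C_k_mult[OF C_k_const, of k g "-1"] by simp

text \<open>\<open>C_k\<close> speaks only of derivatives along basis vectors; linearity recovers
  every other direction from them.\<close>

lemma has_derivative_euclidean_sum:
  fixes f :: "'a::euclidean_space \<Rightarrow> real"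
  assumes "(f has_derivative f') F"
  shows "f' v = (\<Sum>b\<in>Basis. (v \<bullet> b) * f' b)"
proof -
  interpret linear f' using assms has_derivative_linear by blast
  have "f' v = f' (\<Sum>b\<in>Basis. (v \<bullet> b) *\<^sub>R b)" by (simp add: euclidean_representation)
  then show ?thesis by (simp add: sum scale)
qed

lemma C_k_compose_affine:
  fixes f :: "'a::euclidean_space \<Rightarrow> real" and A :: "'b::euclidean_space \<Rightarrow> 'a"
  assumes "linear A"
  shows "C_k k f \<Longrightarrow> C_k k (\<lambda>x. f (A x + c))"
proof (induction k arbitrary: f)
  case 0
  have "continuous_on UNIV (\<lambda>x. A x + c)"
    using assms linear_continuous_on linear_conv_bounded_linear by (intro continuous_intros) blast
  then show ?case using 0 continuous_on_compose2[of UNIV f UNIV "\<lambda>x. A x + c"] by auto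
next
  case (Suc k)
  note d = Suc.prems(1)[THEN C_k_has_derivative]
  have A: "((\<lambda>x. A x + c) has_derivative A) (at x)" for x
    using assms by (auto intro!: derivative_eq_intros bounded_linear_imp_has_derivative
        simp: linear_conv_bounded_linear)
  have D: "((\<lambda>x. f (A x + c)) has_derivative (\<lambda>v. frechet_derivative f (at (A x + c)) (A v))) (at x)" for x
    using has_derivative_compose[OF A d] by simp
  show ?case
  proof (rule C_k_SucI[OF D])
    fix b :: 'b
    \<comment> \<open>The chain rule yields the derivative of \<open>f\<close> along
      \<open>A b\<close>, which is in general no basis vector. Expanding it in the basis makes the
      induction hypothesis applicable.\<close>
    have "(\<lambda>x. frechet_derivative f (at (A x + c)) (A b)) =
       (\<lambda>x. \<Sum>i\<in>Basis. (A b \<bullet> i) * frechet_derivative f (at (A x + c)) i)"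
      using has_derivative_euclidean_sum[OF d] by blast
    moreover have "C_k k (\<lambda>x. \<Sum>i\<in>Basis. (A b \<bullet> i) * frechet_derivative f (at (A x + c)) i)"
      using Suc.prems by (intro C_k_sum C_k_mult C_k_const Suc.IH) auto
    ultimately show "C_k k (\<lambda>x. frechet_derivative f (at (A x + c)) (A b))" by simp
  qed
qed

lemma C_k_affine:
  fixes a :: "'a::euclidean_space"
  shows "C_k k (\<lambda>x. x \<bullet> a + c)"
proof (cases k)
  case 0
  then show ?thesis by (auto intro!: continuous_intros)
next
  case (Suc m)
  show ?thesis unfolding Suc
    by (rule C_k_SucI[where f' = "\<lambda>x v. v \<bullet> a"]) (auto intro!: derivative_eq_intros C_k_const)
qed

text \<open>The functions \<open>flat m\<close> are closed under differentiation up to linear combinations;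
  \<open>flat 0\<close> is the cut-off profile.\<close>

definition flat :: "nat \<Rightarrow> real \<Rightarrow> real" where
  "flat m s = (if s \<le> 0 then 0 else exp (- (1 / s)) / s ^ m)"

text \<open>A single term of the exponential series is at most its sum, all terms being
  nonnegative.\<close>

lemma power_div_fact_le_exp:
  fixes x :: real
  assumes "x \<ge> 0"
  shows "x ^ n / fact n \<le> exp x"
proof -
  have "(\<Sum>i\<in>{n}. inverse (fact i) *\<^sub>R x ^ i) \<le> (\<Sum>i. inverse (fact i) *\<^sub>R x ^ i)"
    using assms by (intro sum_le_suminf summable_exp_generic) auto
  then show ?thesis by (simp add: exp_def field_simps)
qed

text \<open>The exponential beats the term of order \<open>m + 2\<close> of its series. Of these
  powers, \<open>m\<close> cancel the denominator of \<open>flat m\<close> and two remain, so that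
  \<open>flat m h / h\<close> still tends to 0 with \<open>h\<close>.\<close>

lemma flat_bound:
  assumes "s > 0"
  shows "flat m s \<le> fact (Suc (Suc m)) * s\<^sup>2"
proof -
  have "(1 / s) ^ (Suc (Suc m)) / fact (Suc (Suc m)) \<le> exp (1 / s)"
    using assms by (intro power_div_fact_le_exp) auto
  then have "1 / (s ^ (Suc (Suc m)) * exp (1 / s)) \<le> fact (Suc (Suc m))"
    using assms by (simp add: field_simps power_one_over del: fact_Suc)
  then have "1 / (s ^ (Suc (Suc m)) * exp (1 / s)) * s\<^sup>2 \<le> fact (Suc (Suc m)) * s\<^sup>2"
    by (rule mult_right_mono) simp
  moreover have "1 / (s ^ (Suc (Suc m)) * exp (1 / s)) * s\<^sup>2 = flat m s"
    using assms by (simp add: flat_def exp_minus field_simps power2_eq_square)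
  ultimately show ?thesis by simp
qed

lemma flat_nonneg: "flat m s \<ge> 0"
  by (simp add: flat_def)

lemma flat_0_le_1: "flat 0 s \<le> 1"
  by (simp add: flat_def)

text \<open>For positive \<open>s\<close> the factor \<open>exp (- 1 / s)\<close> contributes
  \<open>flat (m + 2)\<close> and the factor \<open>1 / s ^ m\<close> contributes
  \<open>- m * flat (m + 1)\<close>. The delicate point is 0, where the quadratic bound makes the
  difference quotient vanish in the limit.\<close>

lemma flat_has_field_derivative:
  "(flat m has_field_derivative (flat (m + 2) s - m * flat (m + 1) s)) (at s)"
proof -
  consider "s < 0" | "s = 0" | "s > 0" by linarith
  then show ?thesis
  proof cases
    case 1
    have "((\<lambda>x. 0) has_field_derivative 0) (at s)" by simp
    then have "(flat m has_field_derivative 0) (at s)"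
      by (rule has_field_derivative_transform_within_open[where S = "{..<0}"])
         (use 1 in \<open>auto simp: flat_def\<close>)
    then show ?thesis using 1 by (simp add: flat_def)
  next
    case 2
    have lim: "((\<lambda>h. flat m h / h) \<longlongrightarrow> 0) (at 0)"
    proof (rule Lim_null_comparison)
      show "\<forall>\<^sub>F h in at 0. norm (flat m h / h) \<le> fact (Suc (Suc m)) * \<bar>h\<bar>"
        unfolding eventually_at
      proof (intro exI[of _ 1] conjI ballI impI)
        fix h :: real assume "h \<noteq> 0 \<and> dist h 0 < 1"
        then show "norm (flat m h / h) \<le> fact (Suc (Suc m)) * \<bar>h\<bar>"
        proof (cases "h > 0")
          case True
          then show ?thesis
            using flat_bound[of h m] flat_nonneg[of m h]
            by (simp add: divide_le_eq power2_eq_square mult.assoc)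
        qed (simp add: flat_def mult_nonneg_nonpos del: fact_Suc)
      qed simp
      show "((\<lambda>h. fact (Suc (Suc m)) * \<bar>h\<bar>) \<longlongrightarrow> (0::real)) (at 0)"
        by (intro tendsto_eq_intros) auto
    qed
    then show ?thesis using 2 by (simp add: has_field_derivative_iff flat_def[of _ 0])
  next
    case 3
    have "((\<lambda>x. exp (- (1 / x))) has_field_derivative exp (- (1 / s)) / s\<^sup>2) (at s)"
      using 3 by (auto intro!: derivative_eq_intros simp: power2_eq_square)
    moreover have "((\<lambda>x. x ^ m) has_field_derivative m * s ^ (m - 1)) (at s)"
      by (auto intro!: derivative_eq_intros)
    ultimately have "((\<lambda>x. exp (- (1 / x)) / x ^ m) has_field_derivative
        (exp (- (1 / s)) / s\<^sup>2 * s ^ m - exp (- (1 / s)) * (m * s ^ (m - 1))) / (s ^ m * s ^ m)) (at s)"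
      using 3 by (intro DERIV_divide) auto
    also have "(exp (- (1 / s)) / s\<^sup>2 * s ^ m - exp (- (1 / s)) * (m * s ^ (m - 1))) / (s ^ m * s ^ m)
        = flat (m + 2) s - m * flat (m + 1) s"
    proof (cases m)
      case 0
      then show ?thesis using 3 by (simp add: flat_def power2_eq_square)
    next
      case (Suc k)
      \<comment> \<open>With \<open>P\<close> for \<open>s ^ (m - 1)\<close>, every power involved
        is \<open>P\<close> times a small power of \<open>s\<close>, and the identity becomes one of
        rational functions.\<close>
      define P where "P = s ^ k"
      have "P \<noteq> 0" and "s ^ m = s * P" "s ^ (m - 1) = P" "s ^ (m + 1) = s * s * P" "s ^ (m + 2) = s * s * s * P"
        using 3 by (simp_all add: P_def Suc)
      then show ?thesis using 3
        by (simp add: flat_def power2_eq_square field_simps del: power_Suc One_nat_def add_Suc_right)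
    qed
    finally have "((\<lambda>x. exp (- (1 / x)) / x ^ m) has_field_derivative
        (flat (m + 2) s - m * flat (m + 1) s)) (at s)" .
    then show ?thesis
      by (rule has_field_derivative_transform_within_open[where S = "{0<..}"])
         (use 3 in \<open>auto simp: flat_def\<close>)
  qed
qed

lemma flat_affine_has_derivative:
  fixes a :: "'a::euclidean_space"
  shows "((\<lambda>x. flat m (x \<bullet> a + c)) has_derivative
    (\<lambda>v. (v \<bullet> a) * (flat (m + 2) (x \<bullet> a + c) - m * flat (m + 1) (x \<bullet> a + c)))) (at x)"
proof -
  have "((\<lambda>x. x \<bullet> a + c) has_derivative (\<lambda>v. v \<bullet> a)) (at x)"
    by (auto intro!: derivative_eq_intros)
  from has_derivative_compose[OF this flat_has_field_derivative[unfolded has_field_derivative_def]]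
  show ?thesis by (simp add: mult.commute)
qed

lemma C_k_flat:
  fixes a :: "'a::euclidean_space"
  shows "C_k k (\<lambda>x. flat m (x \<bullet> a + c))"
proof (induction k arbitrary: m)
  case 0
  show ?case
    using has_derivative_continuous[OF flat_affine_has_derivative]
    by (auto intro!: continuous_at_imp_continuous_on)
next
  case (Suc k)
  show ?case
    by (rule C_k_SucI[OF flat_affine_has_derivative]) (intro C_k_mult C_k_diff C_k_const Suc)
qed

section \<open>Test functions\<close>

lemma test_functionsI:
  assumes "\<And>k. C_k k \<phi>" "compact K" "K \<subseteq> U" "\<And>x. \<phi> x \<noteq> 0 \<Longrightarrow> x \<in> K"
  shows "\<phi> \<in> test_functions U"
proof -
  have "closure {x. \<phi> x \<noteq> 0} \<subseteq> K"
    using assms by (intro closure_minimal compact_imp_closed) auto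
  then show ?thesis
    unfolding test_functions_def using assms compact_Int_closed[of K "closure {x. \<phi> x \<noteq> 0}"]
    by (auto simp: inf.absorb2)
qed

text \<open>The complement of the closed support is open, so the function is locally constant there
  and its derivative vanishes as well.\<close>

lemma test_functions_support:
  assumes "\<phi> \<in> test_functions U"
  obtains K where "compact K" "K \<subseteq> U" "\<And>x. x \<notin> K \<Longrightarrow> \<phi> x = 0"
    "\<And>x v. x \<notin> K \<Longrightarrow> frechet_derivative \<phi> (at x) v = 0"
proof
  let ?K = "closure {x. \<phi> x \<noteq> 0}"
  show "compact ?K" "?K \<subseteq> U" using assms by (auto simp: test_functions_def)
  show z: "\<And>x. x \<notin> ?K \<Longrightarrow> \<phi> x = 0" using closure_subset[of "{x. \<phi> x \<noteq> 0}"] by blast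
  fix x v assume x: "x \<notin> ?K"
  have "((\<lambda>x. 0) has_derivative (\<lambda>v. 0)) (at x)" by simp
  then have "(\<phi> has_derivative (\<lambda>v. 0)) (at x)"
  proof (rule has_derivative_transform_within_open)
    show "open (- ?K)" "x \<in> - ?K" using x by auto
    show "0 = \<phi> y" if "y \<in> - ?K" for y using z[of y] that by simp
  qed
  from fun_cong[OF frechet_derivative_at[OF this], of v]
  show "frechet_derivative \<phi> (at x) v = 0" by simp
qed

lemma test_functions_support_cball:
  assumes "\<phi> \<in> test_functions U"
  obtains r where "\<And>x. x \<notin> cball 0 r \<Longrightarrow> \<phi> x = 0"
    "\<And>x v. x \<notin> cball 0 r \<Longrightarrow> frechet_derivative \<phi> (at x) v = 0"
proof (rule test_functions_support[OF assms])
  fix K assume K: "compact K" "\<And>x. x \<notin> K \<Longrightarrow> \<phi> x = 0"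
    "\<And>x v. x \<notin> K \<Longrightarrow> frechet_derivative \<phi> (at x) v = 0"
  obtain r where r: "K \<subseteq> cball 0 r"
    using compact_imp_bounded[OF K(1)] by (auto simp: bounded_iff subset_iff)
  show thesis
  proof (rule that)
    show "\<phi> x = 0" if "x \<notin> cball 0 r" for x using r that by (intro K(2)) auto
    show "frechet_derivative \<phi> (at x) v = 0" if "x \<notin> cball 0 r" for x v
      using r that by (intro K(3)) auto
  qed
qed

lemma test_functions_C_k: "\<phi> \<in> test_functions U \<Longrightarrow> C_k k \<phi>"
  by (simp add: test_functions_def)

lemma test_functions_mono: "\<phi> \<in> test_functions U \<Longrightarrow> U \<subseteq> W \<Longrightarrow> \<phi> \<in> test_functions W"
  by (auto simp: test_functions_def)

lemma test_functions_has_derivative: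
  "\<phi> \<in> test_functions U \<Longrightarrow> (\<phi> has_derivative frechet_derivative \<phi> (at x)) (at x)"
  using C_k_has_derivative test_functions_C_k by blast

lemma frechet_derivative_euclidean_sum:
  fixes \<phi> :: "'a::euclidean_space \<Rightarrow> real"
  assumes "\<phi> \<in> test_functions U"
  shows "frechet_derivative \<phi> (at x) v = (\<Sum>b\<in>Basis. (v \<bullet> b) * frechet_derivative \<phi> (at x) b)"
  by (rule has_derivative_euclidean_sum[OF test_functions_has_derivative[OF assms]])

lemma test_functions_derivative:
  assumes "\<phi> \<in> test_functions U"
  shows "(\<lambda>x. frechet_derivative \<phi> (at x) v) \<in> test_functions U"
proof -
  obtain K where K: "compact K" "K \<subseteq> U" "\<And>x v. x \<notin> K \<Longrightarrow> frechet_derivative \<phi> (at x) v = 0"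
    using test_functions_support[OF assms] by metis
  have "C_k k (\<lambda>x. frechet_derivative \<phi> (at x) v)" for k
  proof -
    have "C_k (Suc k) \<phi>" using assms test_functions_C_k by blast
    then have "C_k k (\<lambda>x. \<Sum>b\<in>Basis. (v \<bullet> b) * frechet_derivative \<phi> (at x) b)"
      by (intro C_k_sum C_k_mult C_k_const) auto
    then show ?thesis using frechet_derivative_euclidean_sum[OF assms, of _ v] by simp
  qed
  then show ?thesis using K by (intro test_functionsI[of _ K]) auto
qed

lemma test_functions_continuous: "\<phi> \<in> test_functions U \<Longrightarrow> continuous_on UNIV \<phi>"
  using test_functions_C_k[of \<phi> U 0] by simp

lemma test_functions_borel_measurable: "\<phi> \<in> test_functions U \<Longrightarrow> \<phi> \<in> borel_measurable borel"
  using test_functions_continuous borel_measurable_continuous_onI by blast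

lemma test_functions_bounded:
  assumes "\<phi> \<in> test_functions U"
  obtains B where "B > 0" "\<And>x. \<bar>\<phi> x\<bar> \<le> B"
proof -
  obtain K where K: "compact K" "\<And>x. x \<notin> K \<Longrightarrow> \<phi> x = 0"
    using test_functions_support[OF assms] by metis
  have "compact (\<phi> ` K)"
    using K test_functions_continuous[OF assms]
    by (intro compact_continuous_image) (auto intro: continuous_on_subset)
  then obtain B where "B > 0" "\<And>x. x \<in> K \<Longrightarrow> \<bar>\<phi> x\<bar> \<le> B"
    using compact_imp_bounded bounded_pos by (metis imageI real_norm_def)
  then have "\<bar>\<phi> x\<bar> \<le> B" for x by (cases "x \<in> K") (simp_all add: K(2))
  then show ?thesis using that \<open>B > 0\<close> by blast
qed

text \<open>Each partial derivative is again a test function and hence bounded; the sum of these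
  bounds over the basis serves for all directions.\<close>

lemma test_functions_derivative_bounded:
  assumes "\<phi> \<in> test_functions U"
  obtains B where "B > 0" "\<And>x v. \<bar>frechet_derivative \<phi> (at x) v\<bar> \<le> B * norm v"
proof -
  have "\<exists>B. B > 0 \<and> (\<forall>x. \<bar>frechet_derivative \<phi> (at x) b\<bar> \<le> B)" for b
    using test_functions_bounded[OF test_functions_derivative[OF assms]] by metis
  then obtain B where B: "\<And>b. B b > 0" "\<And>b x. \<bar>frechet_derivative \<phi> (at x) b\<bar> \<le> B b" by metis
  show ?thesis
  proof (rule that[of "\<Sum>b\<in>Basis. B b"])
    show "(\<Sum>b\<in>Basis. B b) > 0" using B by (intro sum_pos) auto
    fix x v
    have "\<bar>frechet_derivative \<phi> (at x) v\<bar> \<le> (\<Sum>b\<in>Basis. \<bar>(v \<bullet> b) * frechet_derivative \<phi> (at x) b\<bar>)"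
      unfolding frechet_derivative_euclidean_sum[OF assms, of x v] by (rule sum_abs)
    also have "\<dots> \<le> (\<Sum>b\<in>Basis. norm v * B b)"
      using B by (intro sum_mono) (auto simp: abs_mult intro!: mult_mono Basis_le_norm)
    finally show "\<bar>frechet_derivative \<phi> (at x) v\<bar> \<le> (\<Sum>b\<in>Basis. B b) * norm v"
      by (simp add: sum_distrib_left mult.commute)
  qed
qed

lemma test_functions_lipschitz:
  assumes "\<phi> \<in> test_functions U"
  obtains B where "B > 0" "\<And>x y. \<bar>\<phi> x - \<phi> y\<bar> \<le> B * norm (x - y)"
proof -
  obtain B where B: "B > 0" "\<And>x v. \<bar>frechet_derivative \<phi> (at x) v\<bar> \<le> B * norm v"
    using test_functions_derivative_bounded[OF assms] by metis
  have "norm (\<phi> x - \<phi> y) \<le> B * norm (x - y)" for x y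
  proof (rule differentiable_bound[of UNIV])
    show "(\<phi> has_derivative frechet_derivative \<phi> (at x)) (at x within UNIV)" for x
      using test_functions_has_derivative[OF assms] by simp
    show "onorm (frechet_derivative \<phi> (at x)) \<le> B" for x
      using B(2)[of x] by (intro onorm_bound) (use B(1) in auto)
  qed auto
  then show ?thesis using that B by auto
qed

lemma test_functions_diff:
  assumes "\<phi> \<in> test_functions U" "\<psi> \<in> test_functions U"
  shows "(\<lambda>x. \<phi> x - \<psi> x) \<in> test_functions U"
proof -
  obtain K where K: "compact K" "K \<subseteq> U" "\<And>x. x \<notin> K \<Longrightarrow> \<phi> x = 0"
    using test_functions_support[OF assms(1)] by metis
  obtain L where L: "compact L" "L \<subseteq> U" "\<And>x. x \<notin> L \<Longrightarrow> \<psi> x = 0"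
    using test_functions_support[OF assms(2)] by metis
  show ?thesis
  proof (rule test_functionsI)
    show "C_k k (\<lambda>x. \<phi> x - \<psi> x)" for k
      by (intro C_k_diff assms[THEN test_functions_C_k])
    show "compact (K \<union> L)" "K \<union> L \<subseteq> U" using K(1,2) L(1,2) by auto
    show "x \<in> K \<union> L" if "\<phi> x - \<psi> x \<noteq> 0" for x
      using K(3)[of x] L(3)[of x] that by fastforce
  qed
qed

lemma test_functions_mult_C_k:
  assumes "\<phi> \<in> test_functions U" "\<And>k. C_k k g"
  shows "(\<lambda>x. g x * \<phi> x) \<in> test_functions U"
proof -
  obtain K where K: "compact K" "K \<subseteq> U" "\<And>x. x \<notin> K \<Longrightarrow> \<phi> x = 0"
    using test_functions_support[OF assms(1)] by metis
  show ?thesis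
  proof (rule test_functionsI)
    show "C_k k (\<lambda>x. g x * \<phi> x)" for k
      by (intro C_k_mult assms(2) assms(1)[THEN test_functions_C_k])
    show "x \<in> K" if "g x * \<phi> x \<noteq> 0" for x
      using K(3)[of x] that by fastforce
  qed (use K in auto)
qed

section \<open>Reflections\<close>

text \<open>For a unit vector \<open>n\<close> this is the reflection through the hyperplane
  \<open>x \<bullet> n = c\<close>, and \<open>mirror n 0\<close> is its linear part. It is defined
  in any inner product space so that the normal \<open>(0, n)\<close> in space-time is covered
  too.\<close>

definition mirror :: "'a::real_inner \<Rightarrow> real \<Rightarrow> 'a \<Rightarrow> 'a" where
  "mirror n c x = x - (2 * (x \<bullet> n - c)) *\<^sub>R n"

lemma mirror_affine: "mirror n c x = mirror n 0 x + (2 * c) *\<^sub>R n"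
  by (simp add: mirror_def algebra_simps)

lemma linear_mirror: "linear (mirror n 0)"
  by (intro linearI) (simp_all add: mirror_def algebra_simps inner_add_left)

lemma mirror_inner: "mirror n 0 u \<bullet> v = u \<bullet> mirror n 0 v"
  by (simp add: mirror_def inner_diff_left inner_diff_right inner_commute)

lemma continuous_on_mirror: "continuous_on A (mirror n c)"
  unfolding mirror_def by (intro continuous_intros)

context
  fixes n :: "'a::real_inner"
  assumes unit: "n \<bullet> n = 1"
begin

lemma mirror_height: "mirror n c x \<bullet> n - c = - (x \<bullet> n - c)"
  by (simp add: mirror_def inner_diff_left unit algebra_simps)

lemma mirror_mirror: "mirror n c (mirror n c x) = x"
proof -
  have "mirror n c (mirror n c x) = mirror n c x - (2 * - (x \<bullet> n - c)) *\<^sub>R n"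
    unfolding mirror_height[symmetric] by (rule mirror_def)
  also have "\<dots> = x" by (simp add: mirror_def flip: scaleR_minus_left)
  finally show ?thesis .
qed

lemma norm_mirror: "norm (mirror n 0 v) = norm v"
  by (simp add: norm_eq_sqrt_inner mirror_inner mirror_mirror)

lemma norm_diff_mirror: "norm (x - mirror n c x) = 2 * \<bar>x \<bullet> n - c\<bar>"
  using unit by (simp add: mirror_def norm_eq_sqrt_inner abs_if)

lemma mirror_image: "x \<in> mirror n c ` A \<longleftrightarrow> mirror n c x \<in> A"
  by (metis image_iff mirror_mirror)

end

text \<open>Let \<open>s\<close> be \<open>m\<close> times the height above the mirror. The cut-off
  \<open>flat 0 (s - 1)\<close> has normal derivative \<open>m * flat 2 (s - 1)\<close>, and an odd
  function is bounded by a constant times the height, so their product is controlled by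
  \<open>s * flat 2 (s - 1)\<close>. The first bound gives the pointwise limit 0, the second the
  domination.\<close>

lemma flat_2_cutoff_bound:
  assumes "s > 1"
  shows "s * flat 2 (s - 1) \<le> 1 / (s - 1) + 1 / (s - 1)\<^sup>2" and "s * flat 2 (s - 1) \<le> 2"
proof -
  \<comment> \<open>In this variable the quantity is \<open>(r + r\<^sup>2) * exp (- r)\<close>. The
    bound 2 then follows from \<open>exp r \<ge> 1 + r + r\<^sup>2 / 2\<close>.\<close>
  define r where "r = 1 / (s - 1)"
  have r: "r > 0" and s: "s = 1 + 1 / r" using assms by (auto simp: r_def)
  have "s * flat 2 (s - 1) = (r + r\<^sup>2) * exp (- r)"
    using r by (simp add: s flat_def field_simps power2_eq_square)
  moreover have "(r + r\<^sup>2) * exp (- r) \<le> (r + r\<^sup>2) * 1"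
    using r by (intro mult_left_mono) auto
  moreover have "(r + r\<^sup>2) * exp (- r) \<le> 2"
    using exp_lower_Taylor_quadratic[of r] r by (simp add: exp_minus field_simps)
  ultimately show "s * flat 2 (s - 1) \<le> 1 / (s - 1) + 1 / (s - 1)\<^sup>2" "s * flat 2 (s - 1) \<le> 2"
    by (auto simp: r_def power_one_over)
qed

section \<open>Invariance of Lebesgue measure under reflections\<close>

text \<open>Preimages of null sets are null because \<open>T\<close> preserves
  \<open>lborel\<close>; this carries measurability and invariance over to the completion.\<close>

lemma measure_preserving_lebesgue:
  fixes T :: "'a::euclidean_space \<Rightarrow> 'a"
  assumes T: "T \<in> borel_measurable borel" and eq: "distr lborel borel T = lborel"
  shows "T \<in> lebesgue \<rightarrow>\<^sub>M lebesgue" and "distr lebesgue lebesgue T = lebesgue"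
proof -
  have T': "T \<in> lborel \<rightarrow>\<^sub>M lborel" using T by simp
  then have T'': "T \<in> lebesgue \<rightarrow>\<^sub>M lborel" by (rule measurable_completion)
  have "distr lborel lborel T = distr lborel borel T" by (rule distr_cong) auto
  then have eq': "distr lebesgue lborel T = lborel"
    using distr_completion[OF T'] eq by simp
  show "T \<in> lebesgue \<rightarrow>\<^sub>M lebesgue"
    by (rule completion.measurable_completion2[OF T'']) (simp add: eq')
  show "distr lebesgue lebesgue T = lebesgue"
    using completion.completion_distr_eq[OF T''] by (simp add: eq')
qed

lemma borel_measurable_mirror: "mirror n c \<in> borel_measurable (borel :: 'a::euclidean_space measure)"
  by (intro borel_measurable_continuous_onI continuous_on_mirror)

text \<open>A reflection is an orthogonal map followed by a translation. Both preserve the volumes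
  of boxes, and these determine \<open>lborel\<close>.\<close>

lemma lborel_distr_mirror_plane:
  fixes n :: plane
  assumes "n \<bullet> n = 1"
  shows "distr lborel borel (mirror n c) = lborel"
proof (rule lborel_eqI[symmetric])
  fix l u :: plane
  assume lu: "\<And>b. b \<in> Basis \<Longrightarrow> l \<bullet> b \<le> u \<bullet> b"
  have o: "orthogonal_transformation (mirror n 0)"
    by (auto simp: orthogonal_transformation linear_mirror norm_mirror[OF assms])
  have B: "box l u \<in> lmeasurable" by simp
  have "mirror n c -` box l u = mirror n c ` box l u"
    using mirror_image[OF assms, of _ c "box l u"] by auto
  also have "\<dots> = (+) ((2 * c) *\<^sub>R n) ` (mirror n 0 ` box l u)"
    unfolding image_image using mirror_affine[of n c] by (intro image_cong) (auto simp: add.commute)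
  finally have v: "mirror n c -` box l u = \<dots>" .
  have m: "mirror n c -` box l u \<in> lmeasurable"
    unfolding v using measurable_orthogonal_image[OF o B] by (rule measurable_translation)
  have "emeasure (distr lborel borel (mirror n c)) (box l u) = emeasure lborel (mirror n c -` box l u)"
    by (subst emeasure_distr) (auto simp: borel_measurable_mirror)
  also have "\<dots> = emeasure lebesgue (mirror n c -` box l u)"
    using measurable_sets[OF borel_measurable_mirror, of "box l u" n c] by simp
  also have "\<dots> = ennreal (measure lebesgue (mirror n c -` box l u))"
    using m by (rule emeasure_eq_measure2)
  also have "measure lebesgue (mirror n c -` box l u) = measure lebesgue (box l u)"
    unfolding v measure_translation by (rule measure_orthogonal_image[OF o B])
  also have "\<dots> = (\<Prod>b\<in>Basis. (u - l) \<bullet> b)"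
    using lu by (simp add: measure_lborel_box_eq)
  finally show "emeasure (distr lborel borel (mirror n c)) (box l u) = (\<Prod>b\<in>Basis. (u - l) \<bullet> b)" .
qed simp

lemma mirror_time: "mirror (0, n) c (t, x) = (t, mirror n c x)"
  by (simp add: mirror_def)

text \<open>The space-time mirror is the product of the identity in time and the mirror in space,
  and \<open>lborel\<close> is the product measure.\<close>

lemma lborel_distr_mirror_time:
  fixes n :: "'a::euclidean_space"
  assumes "distr lborel borel (mirror n c) = lborel"
  shows "distr lborel borel (mirror (0::real, n) c) = lborel"
proof -
  have f: "mirror (0, n) c = (\<lambda>(t::real, x). (t, mirror n c x))"
    by (auto simp: mirror_time fun_eq_iff)
  have "distr lborel borel (\<lambda>t::real. t) \<Otimes>\<^sub>M distr lborel borel (mirror n c) =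
     distr (lborel \<Otimes>\<^sub>M lborel) (borel \<Otimes>\<^sub>M borel) (\<lambda>(t::real, x). (t, mirror n c x))"
    by (rule pair_measure_distr) (auto simp: borel_measurable_mirror assms lborel.sigma_finite_measure_axioms)
  moreover have "distr lborel borel (\<lambda>t::real. t) = lborel"
    by (metis distr_id2 sets_lborel)
  ultimately show ?thesis
    by (simp add: assms f lborel_prod borel_prod)
qed

section \<open>Measurability and integration over a symmetric open set\<close>

text \<open>The instances are the doubled domain and its product with the time axis. Points of the
  hyperplane are fixed by the mirror, so symmetry is a condition off the hyperplane. The part
  \<open>U\<close> above it will be \<open>D\<close>, or \<open>D\<close> times the time
  axis.\<close>

locale mirror_domain =
  fixes n :: "'a::euclidean_space" and c :: real and V :: "'a set"
  assumes unit: "n \<bullet> n = 1"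
    and preserving: "distr lborel borel (mirror n c) = lborel"
    and open_V: "open V"
    and symmetric: "x \<in> V \<Longrightarrow> x \<bullet> n \<noteq> c \<Longrightarrow> mirror n c x \<in> V"
begin

abbreviation S :: "'a \<Rightarrow> 'a" where "S \<equiv> mirror n c"

abbreviation R :: "'a \<Rightarrow> 'a" where "R \<equiv> mirror n 0"

definition U :: "'a set" where "U = V \<inter> {x. c < x \<bullet> n}"

lemma open_U: "open U"
  unfolding U_def by (intro open_Int open_V) (simp add: open_Collect_less continuous_on_inner)

lemma U_lebesgue: "U \<in> sets lebesgue" and V_lebesgue: "V \<in> sets lebesgue"
  using open_U open_V by auto

lemma S_height: "S x \<bullet> n = 2 * c - x \<bullet> n"
  using mirror_height[OF unit, of c x] by simp

lemma S_S: "S (S x) = x"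
  by (rule mirror_mirror[OF unit])

lemma S_mem_V_iff: "x \<bullet> n \<noteq> c \<Longrightarrow> S x \<in> V \<longleftrightarrow> x \<in> V"
  using symmetric[of x] symmetric[of "S x"] S_height[of x] S_S[of x] by auto

lemma S_mem_U: "S x \<in> U \<longleftrightarrow> x \<in> V \<and> x \<bullet> n < c"
  using S_mem_V_iff[of x] S_height[of x] by (auto simp: U_def)

lemma V_cases:
  assumes "x \<bullet> n \<noteq> c"
  shows "x \<in> V \<longleftrightarrow> x \<in> U \<or> S x \<in> U"
  unfolding S_mem_U using assms by (auto simp: U_def)

lemma not_both: "x \<in> U \<Longrightarrow> S x \<notin> U"
  unfolding S_mem_U by (auto simp: U_def)

lemma S_measurable: "S \<in> lebesgue \<rightarrow>\<^sub>M lebesgue"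
  and S_distr: "distr lebesgue lebesgue S = lebesgue"
  using measure_preserving_lebesgue[OF borel_measurable_mirror preserving] by auto

lemma AE_off_line: "AE x in lebesgue. x \<bullet> n \<noteq> c"
proof -
  have "negligible {x. n \<bullet> x = c}" using unit by (intro negligible_hyperplane) auto
  then have "{x. n \<bullet> x = c} \<in> null_sets lebesgue" by (simp add: negligible_iff_null_sets)
  then show ?thesis by (rule AE_not_in[THEN eventually_mono]) (auto simp: inner_commute)
qed

lemma AE_S:
  assumes "AE x in lebesgue. P x"
  shows "AE x in lebesgue. P (S x)"
proof -
  have "AE x in distr lebesgue lebesgue S. P x" unfolding S_distr by (rule assms)
  then show ?thesis by (rule AE_distrD[OF S_measurable])
qed

lemma AE_VI:
  assumes "AE x in lebesgue_on U. P x" "AE x in lebesgue_on U. P (S x)"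
  shows "AE x in lebesgue_on V. P x"
proof -
  have "AE x in lebesgue. x \<in> U \<longrightarrow> P x" "AE x in lebesgue. x \<in> U \<longrightarrow> P (S x)"
    using assms by (simp_all add: AE_restrict_space_iff U_lebesgue)
  from this(1) AE_S[OF this(2)] AE_off_line
  have "AE x in lebesgue. x \<in> V \<longrightarrow> P x"
    by eventually_elim (auto simp: V_cases S_S)
  then show ?thesis by (simp add: AE_restrict_space_iff V_lebesgue)
qed

lemma compose_S_measurable: "f \<in> borel_measurable lebesgue \<Longrightarrow> (\<lambda>x. f (S x)) \<in> borel_measurable lebesgue"
  by (rule measurable_compose[OF S_measurable])

text \<open>Off the hyperplane, which is null, \<open>f\<close> on \<open>V\<close> is the sum of
  \<open>f\<close> cut to \<open>U\<close> and of \<open>f \<circ> S\<close> cut to \<open>U\<close>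
  and then composed with \<open>S\<close>; the two pieces have disjoint supports. The integral
  formulas below use the same splitting and bring the second piece back to \<open>U\<close> by
  invariance of the measure.\<close>

lemma measurable_VI:
  fixes f :: "'a \<Rightarrow> 'b::euclidean_space"
  assumes "f \<in> borel_measurable (lebesgue_on U)" "(\<lambda>x. f (S x)) \<in> borel_measurable (lebesgue_on U)"
  shows "f \<in> borel_measurable (lebesgue_on V)"
proof -
  have 1: "(\<lambda>x. if x \<in> U then f x else 0) \<in> borel_measurable lebesgue"
    and 2: "(\<lambda>x. if x \<in> U then f (S x) else 0) \<in> borel_measurable lebesgue"
    using assms by (simp_all add: borel_measurable_if U_lebesgue)
  have "(\<lambda>x. (if x \<in> U then f x else 0) + (if S x \<in> U then f (S (S x)) else 0)) \<in> borel_measurable lebesgue"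
    using 1 compose_S_measurable[OF 2] by (intro borel_measurable_add) auto
  moreover have "AE x in lebesgue. (if x \<in> U then f x else 0) + (if S x \<in> U then f (S (S x)) else 0) = (if x \<in> V then f x else 0)"
    using AE_off_line by eventually_elim (auto simp: V_cases S_S dest: not_both)
  ultimately have "(\<lambda>x. if x \<in> V then f x else 0) \<in> borel_measurable lebesgue"
    by (rule borel_measurable_AE)
  then show ?thesis by (simp add: borel_measurable_if V_lebesgue)
qed

lemma nn_integral_V:
  assumes "f \<in> borel_measurable (lebesgue_on U)" "(\<lambda>x. f (S x)) \<in> borel_measurable (lebesgue_on U)"
  shows "(\<integral>\<^sup>+x. f x \<partial>lebesgue_on V) = (\<integral>\<^sup>+x. f x \<partial>lebesgue_on U) + (\<integral>\<^sup>+x. f (S x) \<partial>lebesgue_on U)"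
proof -
  have 1: "(\<lambda>x. f x * indicator U x) \<in> borel_measurable lebesgue"
    and 2: "(\<lambda>x. f (S x) * indicator U x) \<in> borel_measurable lebesgue"
    using assms by (simp_all add: borel_measurable_restrict_space_iff_ennreal U_lebesgue)
  have "(\<integral>\<^sup>+x. f x * indicator V x \<partial>lebesgue) =
     (\<integral>\<^sup>+x. f x * indicator U x + f (S (S x)) * indicator U (S x) \<partial>lebesgue)"
    by (rule nn_integral_cong_AE, use AE_off_line in eventually_elim)
       (auto simp: V_cases S_S indicator_def dest: not_both)
  also have "\<dots> = (\<integral>\<^sup>+x. f x * indicator U x \<partial>lebesgue) + (\<integral>\<^sup>+x. f (S (S x)) * indicator U (S x) \<partial>lebesgue)"
    using 1 compose_S_measurable[OF 2] by (intro nn_integral_add) auto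
  also have "(\<integral>\<^sup>+x. f (S (S x)) * indicator U (S x) \<partial>lebesgue) =
      (\<integral>\<^sup>+x. f (S x) * indicator U x \<partial>distr lebesgue lebesgue S)"
    by (rule nn_integral_distr[symmetric, OF S_measurable]) (use 2 S_distr in simp)
  finally show ?thesis
    by (simp add: S_distr nn_integral_restrict_space U_lebesgue V_lebesgue)
qed

lemma integral_V:
  fixes f :: "'a \<Rightarrow> real"
  assumes "integrable (lebesgue_on U) f" "integrable (lebesgue_on U) (\<lambda>x. f (S x))"
  shows "(LINT x|lebesgue_on V. f x) = (LINT x|lebesgue_on U. f x + f (S x))"
proof -
  have 1: "integrable lebesgue (\<lambda>x. indicator U x * f x)"
    and 2: "integrable lebesgue (\<lambda>x. indicator U x * f (S x))"
    using assms by (simp_all add: integrable_restrict_space U_lebesgue)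
  have 3: "integrable lebesgue (\<lambda>x. indicator U (S x) * f (S (S x)))"
    by (rule integrable_distr[OF S_measurable]) (use 2 S_distr in simp)
  have m: "(\<lambda>x. indicator U x * f x + indicator U (S x) * f (S (S x))) \<in> borel_measurable lebesgue"
    using 1 3 by (intro borel_measurable_add) auto
  have ae: "AE x in lebesgue. indicator U x * f x + indicator U (S x) * f (S (S x)) = indicator V x * f x"
    using AE_off_line by eventually_elim (auto simp: V_cases S_S indicator_def dest: not_both)
  have "(LINT x|lebesgue. indicator V x * f x) =
     (LINT x|lebesgue. indicator U x * f x + indicator U (S x) * f (S (S x)))"
    by (rule integral_cong_AE[OF borel_measurable_AE[OF m ae] m])
       (use ae in eventually_elim, simp)
  also have "\<dots> = (LINT x|lebesgue. indicator U x * f x) + (LINT x|lebesgue. indicator U (S x) * f (S (S x)))"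
    by (rule Bochner_Integration.integral_add[OF 1 3])
  also have "(LINT x|lebesgue. indicator U (S x) * f (S (S x))) =
      (LINT x|distr lebesgue lebesgue S. indicator U x * f (S x))"
    by (rule integral_distr[symmetric, OF S_measurable]) (use 2 S_distr in simp)
  finally show ?thesis
    using assms by (simp add: S_distr integral_restrict_space U_lebesgue V_lebesgue)
qed

end

section \<open>Weak identities under reflection\<close>

lemma borel_measurable_derivative_pairing:
  fixes g :: "'a::euclidean_space \<Rightarrow> 'a"
  assumes \<phi>: "\<phi> \<in> test_functions W" and g: "g \<in> borel_measurable lebesgue"
  shows "(\<lambda>x. frechet_derivative \<phi> (at x) (g x)) \<in> borel_measurable lebesgue"
proof -
  have "(\<lambda>x. frechet_derivative \<phi> (at x) b) \<in> borel_measurable lebesgue" for b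
    by (rule measurable_completion)
       (use test_functions_borel_measurable[OF test_functions_derivative[OF \<phi>]] in simp)
  then have "(\<lambda>x. \<Sum>b\<in>Basis. (g x \<bullet> b) * frechet_derivative \<phi> (at x) b) \<in> borel_measurable lebesgue"
    using g by (intro borel_measurable_sum borel_measurable_times borel_measurable_inner) auto
  then show ?thesis
    by (subst frechet_derivative_euclidean_sum[OF \<phi>])
qed

text \<open>Integrability of the field on balls is enough, because the derivative of a test function
  is bounded and vanishes off a ball. This local form is needed in space-time, where the domain is
  unbounded in time.\<close>

lemma integrable_derivative_pairing:
  fixes F :: "'a::euclidean_space \<Rightarrow> 'a"
  assumes \<phi>: "\<phi> \<in> test_functions W" and A: "A \<in> sets lebesgue"
    and F: "\<And>r. set_integrable lebesgue (A \<inter> cball 0 r) F"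
  shows "integrable (lebesgue_on A) (\<lambda>x. frechet_derivative \<phi> (at x) (F x))"
proof -
  obtain r where r: "\<And>x. x \<notin> cball 0 r \<Longrightarrow> \<phi> x = 0"
    "\<And>x v. x \<notin> cball 0 r \<Longrightarrow> frechet_derivative \<phi> (at x) v = 0"
    by (fact test_functions_support_cball[OF \<phi>])
  obtain B where B: "\<And>x v. \<bar>frechet_derivative \<phi> (at x) v\<bar> \<le> B * norm v"
    using test_functions_derivative_bounded[OF \<phi>] by blast
  define g where "g x = indicator (A \<inter> cball 0 r) x *\<^sub>R F x" for x
  have g: "integrable lebesgue g"
    using F[of r] by (simp add: g_def[abs_def] set_integrable_def)
  have lin: "linear (frechet_derivative \<phi> (at x))" for x
    using has_derivative_linear[OF test_functions_has_derivative[OF \<phi>]] .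
  have eq: "indicator A x *\<^sub>R frechet_derivative \<phi> (at x) (F x) = frechet_derivative \<phi> (at x) (g x)" for x
    using r(2)[of x "F x"] linear_0[OF lin[of x]] by (cases "x \<in> cball 0 r") (auto simp: g_def indicator_def)
  have "integrable lebesgue (\<lambda>x. frechet_derivative \<phi> (at x) (g x))"
  proof (rule Bochner_Integration.integrable_bound)
    show "integrable lebesgue (\<lambda>x. B * norm (g x))" using g by simp
    show "AE x in lebesgue. norm (frechet_derivative \<phi> (at x) (g x)) \<le> norm (B * norm (g x))"
      using order_trans[OF B abs_ge_self] by simp
  qed (use g in \<open>auto intro: borel_measurable_derivative_pairing[OF \<phi>]\<close>)
  then show ?thesis
    using A unfolding eq[symmetric] by (simp add: integrable_restrict_space)
qed

lemma integrable_function_pairing: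
  fixes f :: "'a::euclidean_space \<Rightarrow> real"
  assumes \<phi>: "\<phi> \<in> test_functions W" and A: "A \<in> sets lebesgue"
    and f: "\<And>r. set_integrable lebesgue (A \<inter> cball 0 r) f"
  shows "integrable (lebesgue_on A) (\<lambda>x. f x * \<phi> x)"
proof -
  obtain r where r: "\<And>x. x \<notin> cball 0 r \<Longrightarrow> \<phi> x = 0"
    "\<And>x v. x \<notin> cball 0 r \<Longrightarrow> frechet_derivative \<phi> (at x) v = 0"
    by (fact test_functions_support_cball[OF \<phi>])
  obtain B where B: "\<And>x. \<bar>\<phi> x\<bar> \<le> B"
    using test_functions_bounded[OF \<phi>] by blast
  define g where "g x = indicator (A \<inter> cball 0 r) x * f x" for x
  have g: "integrable lebesgue g"
    using f[of r] by (simp add: g_def[abs_def] set_integrable_def)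
  have eq: "indicator A x *\<^sub>R (f x * \<phi> x) = g x * \<phi> x" for x
    using r(1)[of x] by (cases "x \<in> cball 0 r") (auto simp: g_def indicator_def)
  have "integrable lebesgue (\<lambda>x. g x * \<phi> x)"
  proof (rule Bochner_Integration.integrable_bound)
    show "integrable lebesgue (\<lambda>x. B * norm (g x))" using g by simp
    show "AE x in lebesgue. norm (g x * \<phi> x) \<le> norm (B * norm (g x))"
    proof (rule AE_I2)
      fix x
      have "\<bar>g x\<bar> * \<bar>\<phi> x\<bar> \<le> \<bar>g x\<bar> * \<bar>B\<bar>" using B[of x] by (intro mult_left_mono) auto
      then show "norm (g x * \<phi> x) \<le> norm (B * norm (g x))" by (simp add: abs_mult mult.commute)
    qed
    have "\<phi> \<in> borel_measurable lebesgue"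
      using test_functions_borel_measurable[OF \<phi>] by (intro measurable_completion) simp
    then show "(\<lambda>x. g x * \<phi> x) \<in> borel_measurable lebesgue" using g by auto
  qed
  then show ?thesis
    using A unfolding eq[symmetric] by (simp add: integrable_restrict_space)
qed

section \<open>Odd parts of test functions and their cut-offs\<close>

context mirror_domain
begin

lemma S_has_derivative: "(S has_derivative R) (at x)"
proof -
  have "((\<lambda>x. R x + (2 * c) *\<^sub>R n) has_derivative R) (at x)"
    by (auto intro!: derivative_eq_intros bounded_linear_imp_has_derivative linear_mirror
        simp: linear_conv_bounded_linear[symmetric])
  moreover have "S = (\<lambda>x. R x + (2 * c) *\<^sub>R n)" using mirror_affine by (rule ext)
  ultimately show ?thesis by simp
qed

lemma reflected_has_derivative:
  assumes "\<phi> \<in> test_functions W"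
  shows "((\<lambda>x. \<phi> (S x)) has_derivative (\<lambda>v. frechet_derivative \<phi> (at (S x)) (R v))) (at x)"
  by (rule has_derivative_compose[OF S_has_derivative test_functions_has_derivative[OF assms]])

lemma reflected_derivative:
  assumes "\<phi> \<in> test_functions W"
  shows "frechet_derivative (\<lambda>x. \<phi> (S x)) (at x) = (\<lambda>v. frechet_derivative \<phi> (at (S x)) (R v))"
  by (rule frechet_derivative_at[OF reflected_has_derivative[OF assms], symmetric])

lemma reflected_test_function:
  assumes "\<phi> \<in> test_functions W"
  shows "(\<lambda>x. \<phi> (S x)) \<in> test_functions (S ` W)"
proof -
  obtain K where K: "compact K" "K \<subseteq> W" "\<And>x. x \<notin> K \<Longrightarrow> \<phi> x = 0"
    "\<And>x v. x \<notin> K \<Longrightarrow> frechet_derivative \<phi> (at x) v = 0"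
    by (fact test_functions_support[OF assms])
  show ?thesis
  proof (rule test_functionsI)
    show "C_k k (\<lambda>x. \<phi> (S x))" for k
      using C_k_compose_affine[OF linear_mirror[of n] test_functions_C_k[OF assms], where c = "(2 * c) *\<^sub>R n"]
      by (simp add: mirror_affine[of n c, symmetric])
    show "compact (S ` K)"
      by (intro compact_continuous_image continuous_on_mirror K)
    show "S ` K \<subseteq> S ` W" using K by auto
    show "x \<in> S ` K" if "\<phi> (S x) \<noteq> 0" for x
      using K(3)[of "S x"] that mirror_image[OF unit, of x c K] by blast
  qed
qed

lemma odd_part_test_function:
  assumes "\<phi> \<in> test_functions W"
  shows "(\<lambda>x. \<phi> x - \<phi> (S x)) \<in> test_functions (W \<union> S ` W)"
  using assms reflected_test_function[OF assms]
  by (intro test_functions_diff) (auto elim: test_functions_mono)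

lemma odd_part_derivative:
  assumes "\<phi> \<in> test_functions W"
  shows "frechet_derivative (\<lambda>x. \<phi> x - \<phi> (S x)) (at x) =
    (\<lambda>v. frechet_derivative \<phi> (at x) v - frechet_derivative \<phi> (at (S x)) (R v))"
  by (rule frechet_derivative_at[symmetric, OF has_derivative_diff])
     (rule test_functions_has_derivative[OF assms] reflected_has_derivative[OF assms])+

lemma S_U_subset_V: "S ` U \<subseteq> V"
  using S_mem_U[of "S x" for x] S_S by auto

text \<open>Test functions on the doubled domain do not vanish near the mirror; multiplying their odd
  part by \<open>flat 0 (m * (x \<bullet> n - c) - 1)\<close> removes the strip of width \<open>1 / m\<close>.\<close>

lemma cutoff_test_function:
  assumes \<phi>: "\<phi> \<in> test_functions V" and m: "m > 0"
  shows "(\<lambda>x. flat 0 (x \<bullet> (m *\<^sub>R n) + (- m * c - 1)) * (\<phi> x - \<phi> (S x))) \<in> test_functions U"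
proof -
  obtain K where K: "compact K" "K \<subseteq> V" "\<And>x. x \<notin> K \<Longrightarrow> \<phi> x = 0"
    "\<And>x v. x \<notin> K \<Longrightarrow> frechet_derivative \<phi> (at x) v = 0"
    by (fact test_functions_support[OF \<phi>])
  \<comment> \<open>The cut-off vanishes off this closed half-space, whose distance from the mirror
    is \<open>1 / m\<close>. Intersecting with it makes the support a compact subset of
    \<open>U\<close>.\<close>
  let ?H = "{x. c + 1 / m \<le> x \<bullet> n}"
  show ?thesis
  proof (rule test_functionsI)
    show "C_k k (\<lambda>x. flat 0 (x \<bullet> (m *\<^sub>R n) + (- m * c - 1)) * (\<phi> x - \<phi> (S x)))" for k
      by (intro C_k_mult C_k_flat test_functions_C_k[OF odd_part_test_function[OF \<phi>]])
    show "compact ((K \<union> S ` K) \<inter> ?H)"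
      by (intro compact_Int_closed compact_Un K compact_continuous_image continuous_on_mirror
          closed_Collect_le continuous_intros)
    show "(K \<union> S ` K) \<inter> ?H \<subseteq> U"
    proof
      fix x assume x: "x \<in> (K \<union> S ` K) \<inter> ?H"
      moreover have "1 / m > 0" using m by simp
      ultimately have h: "x \<bullet> n > c" by (smt (verit) IntD2 mem_Collect_eq)
      have "x \<in> V \<or> S x \<in> V" using x K(2) by (auto simp: S_S)
      with h show "x \<in> U" using S_mem_V_iff[of x] by (auto simp: U_def)
    qed
    fix x assume nz: "flat 0 (x \<bullet> (m *\<^sub>R n) + (- m * c - 1)) * (\<phi> x - \<phi> (S x)) \<noteq> 0"
    then have "m * (x \<bullet> n) - m * c - 1 > 0" by (auto simp: flat_def split: if_splits)
    then have "x \<in> ?H" using m by (simp add: field_simps)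
    moreover have "x \<in> K \<or> S x \<in> K" using nz K(3)[of x] K(3)[of "S x"] by fastforce
    ultimately show "x \<in> (K \<union> S ` K) \<inter> ?H" using mirror_image[OF unit] by blast
  qed
qed

text \<open>A point and its mirror image are twice the height apart, so the Lipschitz constant of
  \<open>\<phi>\<close> gives the bound.\<close>

lemma odd_part_height_bound:
  assumes "\<phi> \<in> test_functions W"
  obtains B where "B > 0" "\<And>x. \<bar>\<phi> x - \<phi> (S x)\<bar> \<le> B * \<bar>x \<bullet> n - c\<bar>"
proof -
  obtain B where B: "B > 0" "\<And>x y. \<bar>\<phi> x - \<phi> y\<bar> \<le> B * norm (x - y)"
    by (fact test_functions_lipschitz[OF assms])
  show ?thesis
  proof (rule that)
    show "2 * B > 0" using B by simp
    show "\<bar>\<phi> x - \<phi> (S x)\<bar> \<le> 2 * B * \<bar>x \<bullet> n - c\<bar>" for x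
      using B(2)[of x "S x"] by (simp add: norm_diff_mirror[OF unit] mult_ac)
  qed
qed

end

lemma integrable_congI:
  "integrable M f \<Longrightarrow> (\<And>x. x \<in> space M \<Longrightarrow> f x = g x) \<Longrightarrow> integrable M g"
  by (simp cong: Bochner_Integration.integrable_cong)

context mirror_domain
begin

text \<open>The hypothesis is applied to the cut-off functions \<open>\<eta> m\<close>. Their
  derivatives contain the extra term \<open>(F \<bullet> n) * (m + 1) * flat 2 * \<Phi>\<close>,
  which is at most a constant times \<open>norm F\<close> and tends to 0 at every point of
  \<open>U\<close>; thus integrability of \<open>F\<close> suffices for the limit.\<close>

lemma weak_identity_odd_part:
  fixes F :: "'a \<Rightarrow> 'a" and f :: "'a \<Rightarrow> real"
  assumes F: "\<And>r. set_integrable lebesgue (U \<inter> cball 0 r) F"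
    and f: "\<And>r. set_integrable lebesgue (U \<inter> cball 0 r) f"
    and weak: "\<And>\<eta>. \<eta> \<in> test_functions U \<Longrightarrow>
      (LINT x|lebesgue_on U. frechet_derivative \<eta> (at x) (F x) + f x * \<eta> x) = 0"
    and \<phi>: "\<phi> \<in> test_functions V"
  defines "\<Phi> \<equiv> \<lambda>x. \<phi> x - \<phi> (S x)"
  shows "(LINT x|lebesgue_on U. frechet_derivative \<Phi> (at x) (F x) + f x * \<Phi> x) = 0"
proof -
  have \<Phi>: "\<Phi> \<in> test_functions (V \<union> S ` V)"
    unfolding \<Phi>_def by (rule odd_part_test_function[OF \<phi>])
  obtain r where r: "\<And>x. x \<notin> cball 0 r \<Longrightarrow> \<Phi> x = 0"
    "\<And>x v. x \<notin> cball 0 r \<Longrightarrow> frechet_derivative \<Phi> (at x) v = 0"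
    by (fact test_functions_support_cball[OF \<Phi>])
  obtain B0 where B0: "B0 > 0" "\<And>x. \<bar>\<Phi> x\<bar> \<le> B0"
    by (fact test_functions_bounded[OF \<Phi>])
  obtain B1 where B1: "B1 > 0" "\<And>x v. \<bar>frechet_derivative \<Phi> (at x) v\<bar> \<le> B1 * norm v"
    by (fact test_functions_derivative_bounded[OF \<Phi>])
  obtain B2 where B2: "B2 > 0" "\<And>x. \<bar>\<Phi> x\<bar> \<le> B2 * \<bar>x \<bullet> n - c\<bar>"
    unfolding \<Phi>_def by (fact odd_part_height_bound[OF \<phi>])
  \<comment> \<open>The index \<open>Suc m\<close> keeps the scale positive for every
    \<open>m\<close>. The affine form is the one accepted by the lemmas on \<open>flat\<close>;
    \<open>h_eq\<close> gives the readable version.\<close>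
  define h where "h m x = x \<bullet> (real (Suc m) *\<^sub>R n) + (- real (Suc m) * c - 1)" for m x
  have h_eq: "h m x = real (Suc m) * (x \<bullet> n - c) - 1" for m x
    by (simp add: h_def algebra_simps)
  define \<eta> where "\<eta> m = (\<lambda>x. flat 0 (h m x) * \<Phi> x)" for m
  have \<eta>: "\<eta> m \<in> test_functions U" for m
    unfolding \<eta>_def h_def \<Phi>_def by (rule cutoff_test_function[OF \<phi>]) simp
  \<comment> \<open>Product rule. For index 0 the derivative of \<open>flat\<close> is
    \<open>flat 2\<close> alone, since the coefficient of \<open>flat 1\<close> is 0.\<close>
  have D\<eta>: "frechet_derivative (\<eta> m) (at x) v =
      flat 0 (h m x) * frechet_derivative \<Phi> (at x) v + (v \<bullet> n) * (real (Suc m) * flat 2 (h m x)) * \<Phi> x" for m x v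
  proof -
    have "(\<eta> m has_derivative (\<lambda>v. flat 0 (h m x) * frechet_derivative \<Phi> (at x) v +
        (v \<bullet> (real (Suc m) *\<^sub>R n)) * flat 2 (h m x) * \<Phi> x)) (at x)"
      using has_derivative_mult[OF flat_affine_has_derivative[of 0 "real (Suc m) *\<^sub>R n" "- real (Suc m) * c - 1" x]
          test_functions_has_derivative[OF \<Phi>, of x]]
      unfolding \<eta>_def h_def by (simp add: numeral_2_eq_2)
    from frechet_derivative_at[OF this, THEN fun_cong, of v] show ?thesis
      by (simp add: mult_ac)
  qed
  have flat2: "real (Suc m) * (x \<bullet> n - c) * flat 2 (h m x) \<le> 2" if "x \<in> U" for m x
    using flat_2_cutoff_bound(2)[of "real (Suc m) * (x \<bullet> n - c)"]
    by (cases "h m x > 0") (auto simp: h_eq flat_def[of _ "real (Suc m) * (x \<bullet> n - c) - 1"] simp del: of_nat_Suc)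
  define s where "s m x = indicator U x *\<^sub>R (frechet_derivative (\<eta> m) (at x) (F x) + f x * \<eta> m x)" for m x
  define s' where "s' x = indicator U x *\<^sub>R (frechet_derivative \<Phi> (at x) (F x) + f x * \<Phi> x)" for x
  \<comment> \<open>The dominating function: \<open>B1\<close> accounts for the derivative of
    \<open>\<Phi>\<close>, \<open>2 * B2\<close> for the derivative of the cut-off, and
    \<open>B0\<close> for the term with \<open>f\<close>. The ball contains all points where
    \<open>\<Phi>\<close> or its derivative is nonzero.\<close>
  define w where "w x = (B1 + 2 * B2) * norm (indicator (U \<inter> cball 0 r) x *\<^sub>R F x)
      + B0 * norm (indicator (U \<inter> cball 0 r) x *\<^sub>R f x)" for x
  have s_bound: "norm (s m x) \<le> w x" for m x
  proof (cases "x \<in> U \<and> x \<in> cball 0 r")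
    case True
    then have xU: "x \<in> U" and xr: "x \<in> cball 0 r" by auto
    have l: "x \<bullet> n - c > 0" using xU by (simp add: U_def)
    have "\<bar>flat 0 (h m x) * frechet_derivative \<Phi> (at x) (F x)\<bar> \<le> 1 * (B1 * norm (F x))"
      unfolding abs_mult using B1 flat_nonneg flat_0_le_1 by (intro mult_mono) auto
    moreover have "\<bar>(F x \<bullet> n) * (real (Suc m) * flat 2 (h m x)) * \<Phi> x\<bar> \<le> norm (F x) * (2 * B2)"
    proof -
      have "\<bar>F x \<bullet> n\<bar> \<le> norm (F x)"
        using Cauchy_Schwarz_ineq2[of "F x" n] unit by (simp add: norm_eq_sqrt_inner)
      moreover have "(real (Suc m) * flat 2 (h m x)) * \<bar>\<Phi> x\<bar> \<le> 2 * B2"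
      proof -
        have "(real (Suc m) * flat 2 (h m x)) * \<bar>\<Phi> x\<bar> \<le> (real (Suc m) * flat 2 (h m x)) * (B2 * (x \<bullet> n - c))"
          using B2(2)[of x] l flat_nonneg by (intro mult_left_mono) auto
        also have "\<dots> = (real (Suc m) * (x \<bullet> n - c) * flat 2 (h m x)) * B2" by simp
        also have "\<dots> \<le> 2 * B2" using flat2[OF xU] B2 by (intro mult_right_mono) auto
        finally show ?thesis .
      qed
      ultimately have "\<bar>F x \<bullet> n\<bar> * ((real (Suc m) * flat 2 (h m x)) * \<bar>\<Phi> x\<bar>) \<le> norm (F x) * (2 * B2)"
        by (rule mult_mono) (auto simp: flat_nonneg)
      then show ?thesis using flat_nonneg[of 2] by (simp add: abs_mult mult.assoc)
    qed
    moreover have "\<bar>f x * \<eta> m x\<bar> \<le> \<bar>f x\<bar> * (1 * B0)"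
      unfolding abs_mult \<eta>_def using B0 flat_nonneg flat_0_le_1
      by (intro mult_left_mono mult_mono) auto
    ultimately have "\<bar>frechet_derivative (\<eta> m) (at x) (F x) + f x * \<eta> m x\<bar>
        \<le> (B1 + 2 * B2) * norm (F x) + B0 * \<bar>f x\<bar>"
      unfolding D\<eta> by (simp add: algebra_simps)
    then show ?thesis using xU xr by (simp add: s_def w_def)
  next
    case False
    then have "s m x = 0" using False r[of x] unfolding s_def D\<eta> by (auto simp: \<eta>_def)
    moreover have "w x \<ge> 0" using B0 B1 B2 by (simp add: w_def)
    ultimately show ?thesis by simp
  qed
  have w: "integrable lebesgue w"
    using F[of r] f[of r] unfolding w_def set_integrable_def
    by (intro Bochner_Integration.integrable_add integrable_mult_right integrable_norm)
  have s_meas: "s m \<in> borel_measurable lebesgue" for m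
  proof -
    have "integrable (lebesgue_on U) (\<lambda>x. frechet_derivative (\<eta> m) (at x) (F x) + f x * \<eta> m x)"
      by (intro Bochner_Integration.integrable_add integrable_derivative_pairing[OF \<eta>]
          integrable_function_pairing[OF \<eta>] F f U_lebesgue)
    then show ?thesis using U_lebesgue by (simp add: integrable_restrict_space s_def[abs_def])
  qed
  have s'_meas: "s' \<in> borel_measurable lebesgue"
  proof -
    have "integrable (lebesgue_on U) (\<lambda>x. frechet_derivative \<Phi> (at x) (F x) + f x * \<Phi> x)"
      by (intro Bochner_Integration.integrable_add integrable_derivative_pairing[OF \<Phi>]
          integrable_function_pairing[OF \<Phi>] F f U_lebesgue)
    then show ?thesis using U_lebesgue by (simp add: integrable_restrict_space s'_def[abs_def])
  qed
  have lim: "(\<lambda>m. s m x) \<longlonglongrightarrow> s' x" for x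
  proof (cases "x \<in> U")
    case True
    then have l: "x \<bullet> n - c > 0" by (simp add: U_def)
    have h_top: "filterlim (\<lambda>m. h m x) at_top sequentially"
    proof -
      have "filterlim (\<lambda>m. real (Suc m) * (x \<bullet> n - c)) at_top sequentially"
        by (rule filterlim_at_top_mult_tendsto_pos[OF tendsto_const l
              filterlim_compose[OF filterlim_real_sequentially filterlim_Suc]])
      from filterlim_tendsto_add_at_top[OF tendsto_const this, of "- 1"]
      show ?thesis unfolding h_eq by (simp only: add_uminus_conv_diff add.commute[of "- 1"])
    qed
    have inv: "(\<lambda>m. 1 / h m x) \<longlonglongrightarrow> 0"
      using tendsto_inverse_0_at_top[OF h_top] by (simp add: inverse_eq_divide)
    have pos: "\<forall>\<^sub>F m in sequentially. h m x > 0"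
      using h_top by (simp add: filterlim_at_top_dense)
    have f0: "(\<lambda>m. flat 0 (h m x)) \<longlonglongrightarrow> 1"
    proof (rule Lim_transform_eventually)
      show "(\<lambda>m. exp (- (1 / h m x))) \<longlonglongrightarrow> 1"
        using tendsto_exp[OF tendsto_minus[OF inv]] by simp
      show "\<forall>\<^sub>F m in sequentially. exp (- (1 / h m x)) = flat 0 (h m x)"
        using pos by eventually_elim (simp add: flat_def)
    qed
    \<comment> \<open>With \<open>s\<close> equal to \<open>Suc m\<close> times the height, the
      expression is \<open>s * flat 2 (s - 1)\<close> divided by the height. The height is fixed
      here, and the first cut-off bound tends to 0.\<close>
    have f2: "(\<lambda>m. real (Suc m) * flat 2 (h m x)) \<longlonglongrightarrow> 0"
    proof (rule Lim_null_comparison)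
      show "\<forall>\<^sub>F m in sequentially. norm (real (Suc m) * flat 2 (h m x))
          \<le> (1 / h m x + (1 / h m x)\<^sup>2) / (x \<bullet> n - c)"
        using pos
      proof eventually_elim
        case (elim m)
        then have "real (Suc m) * (x \<bullet> n - c) * flat 2 (h m x) \<le> 1 / h m x + (1 / h m x)\<^sup>2"
          using flat_2_cutoff_bound(1)[of "real (Suc m) * (x \<bullet> n - c)"] by (simp add: h_eq power_one_over)
        then show ?case using l flat_nonneg[of 2 "h m x"]
          by (simp add: pos_le_divide_eq mult_ac del: of_nat_Suc)
      qed
      show "(\<lambda>m. (1 / h m x + (1 / h m x)\<^sup>2) / (x \<bullet> n - c)) \<longlonglongrightarrow> 0"
        using tendsto_divide[OF tendsto_add[OF inv tendsto_power[OF inv, of 2]] tendsto_const[of "x \<bullet> n - c"]] l by simp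
    qed
    have "(\<lambda>m. flat 0 (h m x) * frechet_derivative \<Phi> (at x) (F x)
        + (F x \<bullet> n) * (real (Suc m) * flat 2 (h m x)) * \<Phi> x + f x * (flat 0 (h m x) * \<Phi> x))
      \<longlonglongrightarrow> 1 * frechet_derivative \<Phi> (at x) (F x) + (F x \<bullet> n) * 0 * \<Phi> x + f x * (1 * \<Phi> x)"
      by (intro tendsto_add tendsto_mult tendsto_const f0 f2)
    then show ?thesis using True unfolding s_def s'_def D\<eta> by (simp add: \<eta>_def)
  qed (simp add: s_def s'_def)
  have "(\<lambda>m. integral\<^sup>L lebesgue (s m)) \<longlonglongrightarrow> integral\<^sup>L lebesgue s'"
    by (rule integral_dominated_convergence[where w = w])
       (use w s_meas s'_meas lim s_bound in auto)
  moreover have "integral\<^sup>L lebesgue (s m) = 0" for m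
    using weak[OF \<eta>] U_lebesgue by (simp add: s_def[abs_def] integral_restrict_space)
  ultimately have "integral\<^sup>L lebesgue s' = 0"
    by (simp add: LIMSEQ_const_iff)
  then show ?thesis using U_lebesgue by (simp add: s'_def[abs_def] integral_restrict_space)
qed

lemma integrable_V:
  fixes f :: "'a \<Rightarrow> real"
  assumes "integrable (lebesgue_on U) f" "integrable (lebesgue_on U) (\<lambda>x. f (S x))"
  shows "integrable (lebesgue_on V) f"
proof -
  have 1: "integrable lebesgue (\<lambda>x. indicator U x * f x)"
    and 2: "integrable lebesgue (\<lambda>x. indicator U x * f (S x))"
    using assms U_lebesgue by (simp_all add: integrable_restrict_space)
  have 3: "integrable lebesgue (\<lambda>x. indicator U (S x) * f (S (S x)))"
    by (rule integrable_distr[OF S_measurable]) (use 2 S_distr in simp)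
  have ae: "AE x in lebesgue. indicator U x * f x + indicator U (S x) * f (S (S x)) = indicator V x * f x"
    using AE_off_line by eventually_elim (auto simp: V_cases S_S indicator_def dest: not_both)
  have "integrable lebesgue (\<lambda>x. indicator V x * f x)"
    by (rule integrable_cong_AE_imp[OF Bochner_Integration.integrable_add[OF 1 3]])
      (use ae borel_measurable_AE[OF _ ae] 1 3 in auto)
  then show ?thesis using V_lebesgue by (simp add: integrable_restrict_space)
qed

text \<open>The sign rule \<open>F' (S x) = - R (F x)\<close> is what the chain rule calls for: the
  lower half contributes minus the derivative of \<open>\<phi> \<circ> S\<close> along
  \<open>F\<close>, so both halves together test \<open>F\<close> and \<open>f\<close> on
  \<open>U\<close> against the odd part of \<open>\<phi>\<close>. The two integrability claims allow
  the identity to be split again into separate integrals.\<close>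

theorem weak_identity_reflected:
  fixes F F' :: "'a \<Rightarrow> 'a" and f f' :: "'a \<Rightarrow> real"
  assumes F: "\<And>r. set_integrable lebesgue (U \<inter> cball 0 r) F"
    and f: "\<And>r. set_integrable lebesgue (U \<inter> cball 0 r) f"
    and weak: "\<And>\<eta>. \<eta> \<in> test_functions U \<Longrightarrow>
      (LINT x|lebesgue_on U. frechet_derivative \<eta> (at x) (F x) + f x * \<eta> x) = 0"
    and F': "\<And>x. x \<in> U \<Longrightarrow> F' x = F x" "\<And>x. x \<in> U \<Longrightarrow> F' (S x) = - R (F x)"
    and f': "\<And>x. x \<in> U \<Longrightarrow> f' x = f x" "\<And>x. x \<in> U \<Longrightarrow> f' (S x) = - f x"
    and \<phi>: "\<phi> \<in> test_functions V"
  shows "integrable (lebesgue_on V) (\<lambda>x. frechet_derivative \<phi> (at x) (F' x))" (is "integrable _ ?k")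
    and "integrable (lebesgue_on V) (\<lambda>x. f' x * \<phi> x)" (is "integrable _ ?l")
    and "(LINT x|lebesgue_on V. frechet_derivative \<phi> (at x) (F' x) + f' x * \<phi> x) = 0"
proof -
  have \<phi>S: "(\<lambda>x. \<phi> (S x)) \<in> test_functions (S ` V)" by (rule reflected_test_function[OF \<phi>])
  have lin: "linear (frechet_derivative \<phi> (at x))" for x
    using has_derivative_linear[OF test_functions_has_derivative[OF \<phi>]] .
  have kS: "?k (S x) = - frechet_derivative (\<lambda>x. \<phi> (S x)) (at x) (F x)" if "x \<in> U" for x
    using that by (simp add: F' reflected_derivative[OF \<phi>] linear_neg[OF lin])
  have lS: "?l (S x) = - (f x * \<phi> (S x))" if "x \<in> U" for x
    using that by (simp add: f')
  have k1: "integrable (lebesgue_on U) ?k"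
    using integrable_derivative_pairing[OF \<phi> U_lebesgue F]
    by (rule integrable_congI) (auto simp: F')
  have k2: "integrable (lebesgue_on U) (\<lambda>x. ?k (S x))"
    using integrable_minus[OF integrable_derivative_pairing[OF \<phi>S U_lebesgue F]]
    by (rule integrable_congI) (auto simp: kS)
  have l1: "integrable (lebesgue_on U) ?l"
    using integrable_function_pairing[OF \<phi> U_lebesgue f]
    by (rule integrable_congI) (auto simp: f')
  have l2: "integrable (lebesgue_on U) (\<lambda>x. ?l (S x))"
    using integrable_minus[OF integrable_function_pairing[OF \<phi>S U_lebesgue f]]
    by (rule integrable_congI) (auto simp: lS)
  show "integrable (lebesgue_on V) ?k" by (rule integrable_V[OF k1 k2])
  show "integrable (lebesgue_on V) ?l" by (rule integrable_V[OF l1 l2])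
  have "(LINT x|lebesgue_on V. ?k x + ?l x) = (LINT x|lebesgue_on U. (?k x + ?l x) + (?k (S x) + ?l (S x)))"
    by (intro integral_V Bochner_Integration.integrable_add k1 k2 l1 l2)
  also have "\<dots> = (LINT x|lebesgue_on U. frechet_derivative (\<lambda>x. \<phi> x - \<phi> (S x)) (at x) (F x) + f x * (\<phi> x - \<phi> (S x)))"
    by (rule Bochner_Integration.integral_cong)
       (auto simp: kS lS F' f' odd_part_derivative[OF \<phi>] reflected_derivative[OF \<phi>] linear_neg[OF lin] algebra_simps)
  also have "\<dots> = 0" by (rule weak_identity_odd_part[OF F f weak \<phi>])
  finally show "(LINT x|lebesgue_on V. ?k x + ?l x) = 0" .
qed

end

section \<open>The energy estimate\<close>

lemma test_functions_integrable:
  fixes \<eta> :: "'a::euclidean_space \<Rightarrow> real"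
  assumes "\<eta> \<in> test_functions U"
  shows "integrable lborel \<eta>"
proof -
  obtain r where r: "\<And>x. x \<notin> cball 0 r \<Longrightarrow> \<eta> x = 0"
    "\<And>x v. x \<notin> cball 0 r \<Longrightarrow> frechet_derivative \<eta> (at x) v = 0"
    by (fact test_functions_support_cball[OF assms])
  obtain B where B: "B > 0" "\<And>x. \<bar>\<eta> x\<bar> \<le> B"
    by (fact test_functions_bounded[OF assms])
  show ?thesis
  proof (rule Bochner_Integration.integrable_bound)
    show "integrable lborel (\<lambda>x::'a. B * indicator (cball 0 r) x)"
      by (intro integrable_mult_right integrable_real_indicator emeasure_lborel_cball_finite) auto
    show "AE x in lborel. norm (\<eta> x) \<le> norm (B * indicator (cball 0 r) x)"
      using r(1) B by (intro AE_I2) (auto simp: indicator_def)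
  qed (use test_functions_borel_measurable[OF assms] in simp)
qed

lemma test_functions_integral_on:
  fixes \<eta> :: "'a::euclidean_space \<Rightarrow> real"
  assumes \<eta>: "\<eta> \<in> test_functions U" and U: "U \<in> sets lebesgue"
  shows "integrable (lebesgue_on U) \<eta>" and "(LINT x|lebesgue_on U. \<eta> x) = (LINT x|lborel. \<eta> x)"
proof -
  obtain K where K: "compact K" "K \<subseteq> U" "\<And>x. x \<notin> K \<Longrightarrow> \<eta> x = 0"
    "\<And>x v. x \<notin> K \<Longrightarrow> frechet_derivative \<eta> (at x) v = 0"
    by (fact test_functions_support[OF \<eta>])
  have eq: "indicator U x *\<^sub>R \<eta> x = \<eta> x" for x
    using K(2) K(3)[of x] by (cases "x \<in> K") (auto simp: indicator_def)
  note m = test_functions_integrable[OF \<eta>]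
  show "integrable (lebesgue_on U) \<eta>"
    unfolding integrable_restrict_space[OF sets.Int[OF U sets.top]] eq
    using m by (subst integrable_completion) auto
  show "(LINT x|lebesgue_on U. \<eta> x) = (LINT x|lborel. \<eta> x)"
    unfolding integral_restrict_space[OF sets.Int[OF U sets.top]] eq
    using m by (intro integral_completion) auto
qed

text \<open>Every difference quotient has integral 0 by translation invariance, and dominated
  convergence passes to the derivative.\<close>

lemma integral_directional_derivative:
  fixes \<phi> :: "'a::euclidean_space \<Rightarrow> real"
  assumes \<phi>: "\<phi> \<in> test_functions U"
  shows "(LINT x|lborel. frechet_derivative \<phi> (at x) v) = 0"
proof -
  obtain r where r: "\<And>x. x \<notin> cball 0 r \<Longrightarrow> \<phi> x = 0"
    "\<And>x v. x \<notin> cball 0 r \<Longrightarrow> frechet_derivative \<phi> (at x) v = 0"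
    by (fact test_functions_support_cball[OF \<phi>])
  obtain B where B: "B > 0" "\<And>x y. \<bar>\<phi> x - \<phi> y\<bar> \<le> B * norm (x - y)"
    by (fact test_functions_lipschitz[OF \<phi>])
  define h where "h m = inverse (real (Suc m))" for m
  have h: "0 < h m" "h m \<le> 1" for m by (auto simp: h_def field_simps)
  have hlim: "filterlim h (at 0) sequentially"
    unfolding filterlim_at using LIMSEQ_inverse_real_of_nat h(1)
    by (auto simp: h_def[abs_def] less_imp_neq[symmetric])
  define q where "q m x = (\<phi> (h m *\<^sub>R v + x) - \<phi> x) / h m" for m x
  note int = test_functions_integrable[OF \<phi>]
  have shift: "integrable lborel (\<lambda>x. \<phi> (a + x))" "(LINT x|lborel. \<phi> (a + x)) = (LINT x|lborel. \<phi> x)" for a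
  proof -
    have 1: "integrable (distr lborel borel ((+) a)) \<phi>" using int by (simp add: lborel_distr_plus)
    then show "integrable lborel (\<lambda>x. \<phi> (a + x))"
      by (subst (asm) integrable_distr_eq) (use int in auto)
    have "(LINT x|lborel. \<phi> (a + x)) = (LINT x|distr lborel borel ((+) a). \<phi> x)"
      by (subst integral_distr) (use int in auto)
    then show "(LINT x|lborel. \<phi> (a + x)) = (LINT x|lborel. \<phi> x)" by (simp add: lborel_distr_plus)
  qed
  have "(\<lambda>m. LINT x|lborel. q m x) \<longlonglongrightarrow> (LINT x|lborel. frechet_derivative \<phi> (at x) v)"
  \<comment> \<open>The Lipschitz constant bounds the quotients. The steps \<open>h m\<close> are at
    most 1, so a shift moves points by at most \<open>norm v\<close>, which explains the enlarged
    ball.\<close>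
  proof (rule integral_dominated_convergence[where w = "\<lambda>x. B * norm v * indicator (cball 0 (r + norm v)) x"])
    show "(\<lambda>x. frechet_derivative \<phi> (at x) v) \<in> borel_measurable lborel"
      using test_functions_borel_measurable[OF test_functions_derivative[OF \<phi>]] by simp
    show "q m \<in> borel_measurable lborel" for m
      unfolding q_def using int shift(1) by (intro borel_measurable_divide borel_measurable_diff) auto
    show "integrable lborel (\<lambda>x::'a. B * norm v * indicator (cball 0 (r + norm v)) x)"
      by (intro integrable_mult_right integrable_real_indicator emeasure_lborel_cball_finite) auto
    show "AE x in lborel. (\<lambda>m. q m x) \<longlonglongrightarrow> frechet_derivative \<phi> (at x) v"
    proof (rule AE_I2)
      fix x
      have "((\<lambda>s. s *\<^sub>R v + x) has_derivative (\<lambda>s. s *\<^sub>R v)) (at 0)"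
        by (auto intro!: derivative_eq_intros)
      from has_derivative_compose[OF this test_functions_has_derivative[OF \<phi>]]
      have "((\<lambda>s. \<phi> (s *\<^sub>R v + x)) has_derivative (\<lambda>s. frechet_derivative \<phi> (at x) (s *\<^sub>R v))) (at 0)"
        by simp
      moreover have "(\<lambda>s. frechet_derivative \<phi> (at x) (s *\<^sub>R v)) = (*) (frechet_derivative \<phi> (at x) v)"
        using linear_scale[OF has_derivative_linear[OF test_functions_has_derivative[OF \<phi>]]]
        by (auto simp: fun_eq_iff)
      ultimately have "((\<lambda>s. \<phi> (s *\<^sub>R v + x)) has_field_derivative frechet_derivative \<phi> (at x) v) (at 0)"
        by (simp add: has_field_derivative_def)
      then have "((\<lambda>s. (\<phi> (s *\<^sub>R v + x) - \<phi> x) / s) \<longlongrightarrow> frechet_derivative \<phi> (at x) v) (at 0)"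
        by (simp add: has_field_derivative_iff)
      from filterlim_compose[OF this hlim]
      show "(\<lambda>m. q m x) \<longlonglongrightarrow> frechet_derivative \<phi> (at x) v" by (simp add: q_def)
    qed
    show "AE x in lborel. norm (q m x) \<le> B * norm v * indicator (cball 0 (r + norm v)) x" for m
    proof (rule AE_I2)
      fix x
      show "norm (q m x) \<le> B * norm v * indicator (cball 0 (r + norm v)) x"
      proof (cases "x \<in> cball 0 (r + norm v)")
        case True
        have "\<bar>\<phi> (h m *\<^sub>R v + x) - \<phi> x\<bar> \<le> B * (h m * norm v)"
          using B(2)[of "h m *\<^sub>R v + x" x] h[of m] by simp
        then show ?thesis using True h[of m] by (simp add: q_def divide_le_eq mult_ac)
      next
        case False
        have "norm x \<le> norm (h m *\<^sub>R v + x) + norm (h m *\<^sub>R v)"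
          using norm_triangle_ineq4[of "h m *\<^sub>R v + x" "h m *\<^sub>R v"] by simp
        moreover have "norm (h m *\<^sub>R v) \<le> norm v"
          using h[of m] by (simp add: mult_left_le_one_le)
        ultimately have "norm (h m *\<^sub>R v + x) > r" "norm x > r" using False norm_ge_zero[of v] by (auto simp del: norm_ge_zero)
        then show ?thesis using False r(1)[of x] r(1)[of "h m *\<^sub>R v + x"] by (simp add: q_def)
      qed
    qed
  qed
  moreover have "(LINT x|lborel. q m x) = 0" for m
    unfolding q_def using int shift by simp
  ultimately show ?thesis
    by (simp add: LIMSEQ_const_iff)
qed

text \<open>Integrate the derivative of \<open>(x \<bullet> e) * \<phi>\<^sup>2\<close> and absorb the mixed term.\<close>

lemma poincare_inequality:
  fixes \<phi> :: "'a::euclidean_space \<Rightarrow> real"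
  assumes \<phi>: "\<phi> \<in> test_functions U" and U: "U \<in> sets lebesgue" "U \<subseteq> cball 0 r"
    and e: "e \<in> Basis"
  shows "(LINT x|lebesgue_on U. (\<phi> x)\<^sup>2) \<le> 4 * r\<^sup>2 * (LINT x|lebesgue_on U. (frechet_derivative \<phi> (at x) e)\<^sup>2)"
proof -
  let ?d = "\<lambda>x. frechet_derivative \<phi> (at x) e"
  note \<phi>d = test_functions_derivative[OF \<phi>, of e]
  have t1: "(\<lambda>x. (\<phi> x)\<^sup>2) \<in> test_functions U"
    using test_functions_mult_C_k[OF \<phi> test_functions_C_k[OF \<phi>]] by (simp add: power2_eq_square)
  have t2: "(\<lambda>x. (?d x)\<^sup>2) \<in> test_functions U"
    using test_functions_mult_C_k[OF \<phi>d test_functions_C_k[OF \<phi>d]] by (simp add: power2_eq_square)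
  \<comment> \<open>The summand 0 only matches the shape of \<open>C_k_affine\<close>.\<close>
  define F where "F x = (x \<bullet> e + 0) * (\<phi> x)\<^sup>2" for x
  have F: "F \<in> test_functions U"
    unfolding F_def by (rule test_functions_mult_C_k[OF t1 C_k_affine])
  have DF: "frechet_derivative F (at x) e = (\<phi> x)\<^sup>2 + 2 * (x \<bullet> e) * \<phi> x * ?d x" for x
  proof -
    have "(F has_derivative (\<lambda>v. (v \<bullet> e) * (\<phi> x)\<^sup>2 + (x \<bullet> e) * (2 * \<phi> x * frechet_derivative \<phi> (at x) v))) (at x)"
      unfolding F_def
      by (auto intro!: derivative_eq_intros test_functions_has_derivative[OF \<phi>] simp: fun_eq_iff power2_eq_square algebra_simps)
    from frechet_derivative_at[OF this, THEN fun_cong, of e] show ?thesis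
      using e by (simp add: inner_Basis)
  qed
  have 0: "(LINT x|lborel. frechet_derivative F (at x) e) = 0"
    by (rule integral_directional_derivative[OF F])
  \<comment> \<open>Right side minus left side is at least
    \<open>(\<phi> x + 2 * (x \<bullet> e) * ?d x)\<^sup>2\<close>, as
    \<open>\<bar>x \<bullet> e\<bar> \<le> r\<close> on the ball. The derivative of \<open>F\<close>
    integrates to 0, which leaves the constant \<open>4 * r\<^sup>2\<close>.\<close>
  have pw: "(\<phi> x)\<^sup>2 \<le> 2 * frechet_derivative F (at x) e + 4 * r\<^sup>2 * (?d x)\<^sup>2" for x
  proof (cases "x \<in> cball 0 r")
    case True
    then have "\<bar>x \<bullet> e\<bar> \<le> r" using Basis_le_norm[OF e, of x] by simp
    then have "(x \<bullet> e)\<^sup>2 \<le> r\<^sup>2" by (metis abs_ge_zero power2_abs power_mono)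
    then have "(x \<bullet> e)\<^sup>2 * (?d x)\<^sup>2 \<le> r\<^sup>2 * (?d x)\<^sup>2" by (rule mult_right_mono) simp
    moreover have "0 \<le> (\<phi> x + 2 * (x \<bullet> e) * ?d x)\<^sup>2" by simp
    ultimately show ?thesis unfolding DF by (simp add: power2_eq_square algebra_simps)
  next
    case False
    obtain K where K: "compact K" "K \<subseteq> U" "\<And>x. x \<notin> K \<Longrightarrow> \<phi> x = 0"
      "\<And>x v. x \<notin> K \<Longrightarrow> frechet_derivative \<phi> (at x) v = 0"
      by (fact test_functions_support[OF \<phi>])
    have "x \<notin> K" using False K(2) U(2) by blast
    then show ?thesis unfolding DF using K(3,4)[of x] by simp
  qed
  have "(LINT x|lborel. (\<phi> x)\<^sup>2) \<le> (LINT x|lborel. 2 * frechet_derivative F (at x) e + 4 * r\<^sup>2 * (?d x)\<^sup>2)"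
    using test_functions_integrable[OF t1] test_functions_integrable[OF t2]
      test_functions_integrable[OF test_functions_derivative[OF F]]
    by (intro integral_mono pw) auto
  also have "\<dots> = 4 * r\<^sup>2 * (LINT x|lborel. (?d x)\<^sup>2)"
    using 0 test_functions_integrable[OF t2]
      test_functions_integrable[OF test_functions_derivative[OF F]] by simp
  finally show ?thesis
    by (simp add: test_functions_integral_on[OF t1 U(1)] test_functions_integral_on[OF t2 U(1)])
qed

text \<open>A Lebesgue measurable function on a product need not be measurable for the product
  sigma-algebra. Tonelli is applied to a Borel version, and almost all sections of the exceptional
  null set are null.\<close>

lemma nn_integral_lebesgue_prod:
  fixes H :: "'a::euclidean_space \<times> 'b::euclidean_space \<Rightarrow> ennreal"
  assumes "H \<in> borel_measurable lebesgue"
  shows "(\<integral>\<^sup>+p. H p \<partial>lebesgue) = (\<integral>\<^sup>+t. (\<integral>\<^sup>+x. H (t, x) \<partial>lebesgue) \<partial>lebesgue)"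
proof -
  obtain G where G: "G \<in> borel_measurable lborel" and eq: "AE p in lborel. H p = G p"
    using completion_ex_borel_measurable[OF assms] by blast
  have G': "G \<in> borel_measurable (lborel \<Otimes>\<^sub>M lborel)" using G by (simp add: lborel_prod)
  have "AE p in lborel \<Otimes>\<^sub>M lborel. H p = G p" unfolding lborel_prod by (rule eq)
  then have ae: "AE t in lborel. AE x in lborel. H (t, x) = G (t, x)"
    by (rule lborel_pair.AE_pair)
  have "(\<integral>\<^sup>+p. H p \<partial>lebesgue) = (\<integral>\<^sup>+p. G p \<partial>(lborel \<Otimes>\<^sub>M lborel))"
    using nn_integral_cong_AE[OF eq] by (simp add: nn_integral_completion lborel_prod)
  also have "\<dots> = (\<integral>\<^sup>+t. (\<integral>\<^sup>+x. G (t, x) \<partial>lborel) \<partial>lborel)"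
    by (rule lborel.nn_integral_fst[OF G', symmetric])
  also have "\<dots> = (\<integral>\<^sup>+t. (\<integral>\<^sup>+x. H (t, x) \<partial>lborel) \<partial>lborel)"
    by (rule nn_integral_cong_AE, use ae in eventually_elim) (rule nn_integral_cong_AE, auto)
  finally show ?thesis by (simp add: nn_integral_completion)
qed

section \<open>Gradients of test functions and the energy of the Dirichlet problem\<close>

lemma grad_inner:
  assumes "\<phi> differentiable (at x)"
  shows "v \<bullet> grad \<phi> x = frechet_derivative \<phi> (at x) v"
proof -
  have "(\<phi> has_derivative frechet_derivative \<phi> (at x)) (at x)"
    using assms by (simp add: frechet_derivative_works)
  then have lin: "linear (frechet_derivative \<phi> (at x))" by (rule has_derivative_linear)
  have "v = (\<Sum>i\<in>UNIV. v $ i *\<^sub>R axis i 1)"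
    using basis_expansion[of v] by (simp add: scalar_mult_eq_scaleR)
  then have "frechet_derivative \<phi> (at x) v = frechet_derivative \<phi> (at x) (\<Sum>i\<in>UNIV. v $ i *\<^sub>R axis i 1)"
    by simp
  also have "\<dots> = (\<Sum>i\<in>UNIV. v $ i * frechet_derivative \<phi> (at x) (axis i 1))"
    by (simp add: linear_sum[OF lin] linear_scale[OF lin])
  finally show ?thesis by (simp add: grad_def inner_vec_def)
qed

lemma test_functions_grad:
  assumes \<phi>: "\<phi> \<in> test_functions U"
  shows "v \<bullet> grad \<phi> x = frechet_derivative \<phi> (at x) v"
  using test_functions_has_derivative[OF \<phi>] by (intro grad_inner) (auto simp: differentiable_def)

lemma test_functions_grad_measurable:
  assumes \<phi>: "\<phi> \<in> test_functions W" and A: "A \<in> sets lebesgue"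
  shows "grad \<phi> \<in> borel_measurable (lebesgue_on A)"
proof (rule borel_measurable_euclidean_space[THEN iffD2], intro ballI)
  fix b :: plane assume "b \<in> Basis"
  have "(\<lambda>x. b \<bullet> grad \<phi> x) \<in> borel_measurable lebesgue"
    unfolding test_functions_grad[OF \<phi>]
    using test_functions_borel_measurable[OF test_functions_derivative[OF \<phi>]]
    by (intro measurable_completion) simp
  then show "(\<lambda>x. grad \<phi> x \<bullet> b) \<in> borel_measurable (lebesgue_on A)"
    by (simp add: inner_commute measurable_restrict_space1)
qed

text \<open>The proof uses the polarization
  \<open>\<bar>g\<bar>\<^sup>2 + \<bar>grad \<phi>\<bar>\<^sup>2 - \<bar>grad \<phi> - g\<bar>\<^sup>2 = 2 * g \<bullet> grad \<phi>\<close> with a test function \<open>\<phi>\<close> close to \<open>\<psi>\<close>.\<close>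

lemma dirichlet_energy_bound:
  assumes sol: "dirichlet_solution U f \<psi> g"
    and U: "open U" "U \<subseteq> cball 0 r" "r > 0"
    and f: "f \<in> borel_measurable (lebesgue_on U)" "AE x in lebesgue_on U. \<bar>f x\<bar> \<le> M"
  shows "integrable (lebesgue_on U) (\<lambda>x. (norm (g x))\<^sup>2)"
    and "(LINT x|lebesgue_on U. (norm (g x))\<^sup>2) \<le> 1 + 4 * r\<^sup>2 * M\<^sup>2 * measure lebesgue U"
proof -
  let ?M = "lebesgue_on U"
  have Ul: "U \<in> sets lebesgue" using U(1) by simp
  have Ufin: "emeasure lebesgue U < \<infinity>"
    using emeasure_mono[OF U(2), of lebesgue] emeasure_lborel_cball_finite[of "0::plane" r]
    by (simp add: order.strict_trans1)
  have const: "integrable ?M (\<lambda>x. k)" for k :: real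
    using Ufin Ul by (simp add: integrable_restrict_space)
  have gm: "g \<in> borel_measurable ?M" using sol by (simp add: dirichlet_solution_def H10_def)
  obtain \<Phi> where \<Phi>: "\<And>n. \<Phi> n \<in> test_functions U"
      "(\<lambda>n::nat. \<integral>\<^sup>+x. ennreal ((norm (grad (\<Phi> n) x - g x))\<^sup>2) \<partial>?M) \<longlonglongrightarrow> 0"
    using sol unfolding dirichlet_solution_def H10_def by blast
  have "\<forall>\<^sub>F n in sequentially. (\<integral>\<^sup>+x. ennreal ((norm (grad (\<Phi> n) x - g x))\<^sup>2) \<partial>?M) < 1"
    by (rule order_tendstoD(2)[OF \<Phi>(2)]) simp
  \<comment> \<open>A single approximant with error below 1 suffices; this error is the summand 1 of
    the final bound, which is thereby independent of the approximating sequence.\<close>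
  then obtain n where n: "(\<integral>\<^sup>+x. ennreal ((norm (grad (\<Phi> n) x - g x))\<^sup>2) \<partial>?M) < 1"
    by (auto simp: eventually_sequentially)
  define \<phi> where "\<phi> = \<Phi> n"
  have \<phi>: "\<phi> \<in> test_functions U" by (simp add: \<phi>_def \<Phi>(1))
  define d where "d i x = frechet_derivative \<phi> (at x) (axis i 1)" for i :: 2 and x
  have d: "d i \<in> test_functions U" for i
    unfolding d_def by (rule test_functions_derivative[OF \<phi>])
  have sq: "(\<lambda>x. (\<eta> x)\<^sup>2) \<in> test_functions U" if "\<eta> \<in> test_functions U" for \<eta> :: "plane \<Rightarrow> real"
    using test_functions_mult_C_k[OF that test_functions_C_k[OF that]] by (simp add: power2_eq_square)
  note tint = test_functions_integral_on(1)[OF _ Ul]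
  have gradn: "(norm (grad \<phi> x))\<^sup>2 = (d 1 x)\<^sup>2 + (d 2 x)\<^sup>2" for x
    unfolding power2_norm_eq_inner inner_vec_def sum_2 grad_def d_def by (simp add: power2_eq_square)
  have i1: "integrable ?M (\<lambda>x. (norm (grad \<phi> x))\<^sup>2)"
    unfolding gradn by (intro Bochner_Integration.integrable_add tint sq d)
  have gradm: "grad \<phi> \<in> borel_measurable ?M" by (rule test_functions_grad_measurable[OF \<phi> Ul])
  have i2: "integrable ?M (\<lambda>x. (norm (grad \<phi> x - g x))\<^sup>2)"
    and le1: "(LINT x|?M. (norm (grad \<phi> x - g x))\<^sup>2) \<le> 1"
  proof -
    have m: "(\<lambda>x. (norm (grad \<phi> x - g x))\<^sup>2) \<in> borel_measurable ?M"
      using gradm gm by measurable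
    show i: "integrable ?M (\<lambda>x. (norm (grad \<phi> x - g x))\<^sup>2)"
      using n by (intro integrableI_nonneg m) (auto simp: \<phi>_def intro: less_trans)
    have "ennreal (LINT x|?M. (norm (grad \<phi> x - g x))\<^sup>2) \<le> ennreal 1"
      using nn_integral_eq_integral[OF i] n by (simp add: \<phi>_def)
    then show "(LINT x|?M. (norm (grad \<phi> x - g x))\<^sup>2) \<le> 1" by simp
  qed
  show i3: "integrable ?M (\<lambda>x. (norm (g x))\<^sup>2)"
  proof (rule Bochner_Integration.integrable_bound)
    show "integrable ?M (\<lambda>x. 2 * (norm (grad \<phi> x))\<^sup>2 + 2 * (norm (grad \<phi> x - g x))\<^sup>2)"
      using i1 i2 by simp
    have "(norm (g x))\<^sup>2 \<le> 2 * (norm (grad \<phi> x))\<^sup>2 + 2 * (norm (grad \<phi> x - g x))\<^sup>2" for x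
    proof -
      \<comment> \<open>This square is exactly the difference of the two sides of the claim.\<close>
      have "0 \<le> (norm (2 *\<^sub>R grad \<phi> x - g x))\<^sup>2" by simp
      then show ?thesis
        by (simp add: power2_norm_eq_inner inner_diff_left inner_diff_right inner_commute)
    qed
    then show "AE x in ?M. norm ((norm (g x))\<^sup>2) \<le> norm (2 * (norm (grad \<phi> x))\<^sup>2 + 2 * (norm (grad \<phi> x - g x))\<^sup>2)"
      by simp
  qed (use gm in measurable)
  have polar: "g x \<bullet> grad \<phi> x = ((norm (g x))\<^sup>2 + (norm (grad \<phi> x))\<^sup>2 - (norm (grad \<phi> x - g x))\<^sup>2) / 2" for x
    by (simp add: power2_norm_eq_inner inner_diff_left inner_diff_right inner_commute)
  \<comment> \<open>The weight \<open>1 / (8 * r\<^sup>2)\<close> is matched to the constant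
    \<open>4 * r\<^sup>2\<close> of the Poincare inequality: their product is one half, and after
    the factor 2 from polarization the gradient of \<open>\<phi>\<close> cancels on both
    sides.\<close>
  have young: "- (f x * \<phi> x) \<le> 2 * r\<^sup>2 * M\<^sup>2 + (\<phi> x)\<^sup>2 / (8 * r\<^sup>2)" if "\<bar>f x\<bar> \<le> M" for x
  proof -
    have "- (f x * \<phi> x) \<le> \<bar>f x\<bar> * \<bar>\<phi> x\<bar>" by (metis abs_ge_minus_self abs_mult)
    also have "\<dots> \<le> M * \<bar>\<phi> x\<bar>" using that by (intro mult_right_mono) auto
    also have "\<dots> \<le> 2 * r\<^sup>2 * M\<^sup>2 + (\<phi> x)\<^sup>2 / (8 * r\<^sup>2)"
    proof -
      have "0 \<le> (4 * r\<^sup>2 * M - \<bar>\<phi> x\<bar>)\<^sup>2 / (8 * r\<^sup>2)" by simp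
      also have "\<dots> = 2 * r\<^sup>2 * M\<^sup>2 + (\<phi> x)\<^sup>2 / (8 * r\<^sup>2) - M * \<bar>\<phi> x\<bar>"
        using U(3) by (simp add: power2_diff field_simps power2_eq_square)
      finally show ?thesis by simp
    qed
    finally show ?thesis .
  qed
  have rhs: "integrable ?M (\<lambda>x. 2 * r\<^sup>2 * M\<^sup>2 + (\<phi> x)\<^sup>2 / (8 * r\<^sup>2))"
    using const tint[OF sq[OF \<phi>]] by simp
  have "(LINT x|?M. (norm (g x))\<^sup>2) + (LINT x|?M. (norm (grad \<phi> x))\<^sup>2) - (LINT x|?M. (norm (grad \<phi> x - g x))\<^sup>2)
      = 2 * (LINT x|?M. g x \<bullet> grad \<phi> x)"
    unfolding polar using i1 i2 i3 by simp
  also have "(LINT x|?M. g x \<bullet> grad \<phi> x) = (LINT x|?M. - (f x * \<phi> x))"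
    using sol \<phi> by (simp add: dirichlet_solution_def)
  also have "\<dots> \<le> (LINT x|?M. 2 * r\<^sup>2 * M\<^sup>2 + (\<phi> x)\<^sup>2 / (8 * r\<^sup>2))"
  proof (rule integral_mono_AE[OF _ rhs])
    have "integrable ?M (\<lambda>x. f x * \<phi> x)"
    proof (rule Bochner_Integration.integrable_bound)
      show "integrable ?M (\<lambda>x. M * \<phi> x)" using tint[OF \<phi>] by simp
      show "(\<lambda>x. f x * \<phi> x) \<in> borel_measurable ?M" using f(1) tint[OF \<phi>] by auto
      show "AE x in ?M. norm (f x * \<phi> x) \<le> norm (M * \<phi> x)"
        using f(2) by eventually_elim (auto simp: abs_mult intro!: mult_right_mono)
    qed
    then show "integrable ?M (\<lambda>x. - (f x * \<phi> x))" by simp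
    show "AE x in ?M. - (f x * \<phi> x) \<le> 2 * r\<^sup>2 * M\<^sup>2 + (\<phi> x)\<^sup>2 / (8 * r\<^sup>2)"
      using f(2) by eventually_elim (rule young)
  qed
  also have "\<dots> = 2 * r\<^sup>2 * M\<^sup>2 * measure lebesgue U + (LINT x|?M. (\<phi> x)\<^sup>2) / (8 * r\<^sup>2)"
    using const tint[OF sq[OF \<phi>]] Ul by (simp add: measure_restrict_space)
  also have "(LINT x|?M. (\<phi> x)\<^sup>2) / (8 * r\<^sup>2) \<le> (LINT x|?M. (norm (grad \<phi> x))\<^sup>2) / 2"
  proof -
    have "axis 1 1 \<in> (Basis :: plane set)" by (auto simp: Basis_vec_def)
    from poincare_inequality[OF \<phi> Ul U(2) this]
    have "(LINT x|?M. (\<phi> x)\<^sup>2) \<le> 4 * r\<^sup>2 * (LINT x|?M. (d 1 x)\<^sup>2)" by (simp add: d_def)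
    also have "\<dots> \<le> 4 * r\<^sup>2 * (LINT x|?M. (norm (grad \<phi> x))\<^sup>2)"
      by (intro mult_left_mono integral_mono tint sq d i1) (auto simp: gradn)
    finally show ?thesis using U(3) by (simp add: field_simps)
  qed
  finally show "(LINT x|?M. (norm (g x))\<^sup>2) \<le> 1 + 4 * r\<^sup>2 * M\<^sup>2 * measure lebesgue U"
    using le1 by (simp add: algebra_simps)
qed

text \<open>The norm of \<open>(\<omega>, \<omega> u)\<close> is at most
  \<open>\<bar>\<omega>\<bar> * (1 + norm u)\<close>, whose spatial integral is bounded by
  \<open>C\<close> for almost every time. A ball meets only the times in \<open>{-r..r}\<close>, so
  Tonelli gives a finite integral.\<close>

lemma set_integrable_spacetime:
  fixes \<omega> :: "real \<Rightarrow> plane \<Rightarrow> real" and u :: "real \<Rightarrow> plane \<Rightarrow> plane"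
  assumes D: "open D"
    and \<omega>: "(\<lambda>(t, x). \<omega> t x) \<in> borel_measurable (lebesgue_on (UNIV \<times> D))"
    and u: "(\<lambda>(t, x). u t x) \<in> borel_measurable (lebesgue_on (UNIV \<times> D))"
    and bound: "AE t in lebesgue. AE x in lebesgue_on D. \<bar>\<omega> t x\<bar> \<le> M"
    and u_bound: "AE t in lebesgue. (\<integral>\<^sup>+x. ennreal (M * (1 + norm (u t x))) \<partial>lebesgue_on D) \<le> ennreal C"
  shows "set_integrable lebesgue ((UNIV \<times> D) \<inter> cball 0 r) (\<lambda>(t, x). (\<omega> t x, \<omega> t x *\<^sub>R u t x))"
proof -
  let ?F = "\<lambda>(t, x). (\<omega> t x, \<omega> t x *\<^sub>R u t x)"
  have W: "open (UNIV \<times> D :: (real \<times> plane) set)" using D by (intro open_Times) auto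
  then have Wl: "(UNIV \<times> D :: (real \<times> plane) set) \<in> sets lebesgue" by simp
  have F: "?F \<in> borel_measurable (lebesgue_on (UNIV \<times> D))"
  proof -
    have "(\<lambda>p. ((\<lambda>(t, x). \<omega> t x) p, (\<lambda>(t, x). \<omega> t x) p *\<^sub>R (\<lambda>(t, x). u t x) p)) \<in> borel_measurable (lebesgue_on (UNIV \<times> D))"
      by (intro borel_measurable_Pair borel_measurable_scaleR \<omega> u)
    then show ?thesis by (simp add: case_prod_beta)
  qed
  then have "(\<lambda>p. if p \<in> UNIV \<times> D then ?F p else 0) \<in> borel_measurable lebesgue"
    using Wl by (simp only: borel_measurable_if)
  then have "(\<lambda>p. indicator (cball 0 r) p *\<^sub>R (if p \<in> UNIV \<times> D then ?F p else 0)) \<in> borel_measurable lebesgue"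
    by (intro borel_measurable_scaleR borel_measurable_indicator) auto
  moreover have "(\<lambda>p. indicator (cball 0 r) p *\<^sub>R (if p \<in> UNIV \<times> D then ?F p else 0)) =
      (\<lambda>p. indicator ((UNIV \<times> D) \<inter> cball 0 r) p *\<^sub>R ?F p)"
    by (auto simp: indicator_def fun_eq_iff zero_prod_def)
  ultimately have m: "(\<lambda>p. indicator ((UNIV \<times> D) \<inter> cball 0 r) p *\<^sub>R ?F p) \<in> borel_measurable lebesgue"
    by simp
  let ?H = "\<lambda>p. ennreal (norm (indicator ((UNIV \<times> D) \<inter> cball 0 r) p *\<^sub>R ?F p))"
  have "(\<integral>\<^sup>+p. ?H p \<partial>lebesgue) = (\<integral>\<^sup>+t. (\<integral>\<^sup>+x. ?H (t, x) \<partial>lebesgue) \<partial>lebesgue)"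
    by (intro nn_integral_lebesgue_prod measurable_compose[OF m]) simp
  also have "\<dots> \<le> (\<integral>\<^sup>+t. ennreal C * indicator {-r..r} t \<partial>lebesgue)"
  proof (rule nn_integral_mono_AE, use bound u_bound in eventually_elim)
    fix t
    assume b: "AE x in lebesgue_on D. \<bar>\<omega> t x\<bar> \<le> M"
      and ub: "(\<integral>\<^sup>+x. ennreal (M * (1 + norm (u t x))) \<partial>lebesgue_on D) \<le> ennreal C"
    show "(\<integral>\<^sup>+x. ?H (t, x) \<partial>lebesgue) \<le> ennreal C * indicator {-r..r} t"
    proof (cases "t \<in> {-r..r}")
      case True
      have "AE x in lebesgue. x \<in> D \<longrightarrow> \<bar>\<omega> t x\<bar> \<le> M"
        using b D by (simp add: AE_restrict_space_iff)
      then have "(\<integral>\<^sup>+x. ?H (t, x) \<partial>lebesgue) \<le> (\<integral>\<^sup>+x. ennreal (M * (1 + norm (u t x))) * indicator D x \<partial>lebesgue)"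
      proof (intro nn_integral_mono_AE, eventually_elim)
        fix x assume bx: "x \<in> D \<longrightarrow> \<bar>\<omega> t x\<bar> \<le> M"
        have "norm (\<omega> t x, \<omega> t x *\<^sub>R u t x) \<le> \<bar>\<omega> t x\<bar> * (1 + norm (u t x))"
          using norm_Pair_le[of "\<omega> t x" "\<omega> t x *\<^sub>R u t x"] by (simp add: algebra_simps)
        also have "x \<in> D \<Longrightarrow> \<dots> \<le> M * (1 + norm (u t x))"
          using bx by (intro mult_right_mono) auto
        finally show "?H (t, x) \<le> ennreal (M * (1 + norm (u t x))) * indicator D x"
          by (auto simp: indicator_def intro: ennreal_leI)
      qed
      also have "\<dots> \<le> ennreal C" using ub D by (simp add: nn_integral_restrict_space)
      finally show ?thesis using True by simp
    next
      case False
      have "(t, x) \<notin> cball 0 r" for x :: plane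
        using False norm_fst_le[of t x] by auto
      then show ?thesis by simp
    qed
  qed
  also have "\<dots> = ennreal C * emeasure lebesgue {-r..r}"
    by (intro nn_integral_cmult_indicator) auto
  also have "\<dots> < \<infinity>"
    by (simp add: ennreal_mult_less_top emeasure_lborel_Icc_eq)
  finally show ?thesis
    unfolding set_integrable_def by (intro integrableI_bounded m)
qed

section \<open>Geometry of the doubled domain\<close>

text \<open>A reflection reverses orientation, hence it anticommutes with the rotation by a right
  angle.\<close>

lemma perp_mirror:
  assumes "n \<bullet> n = 1"
  shows "perp (mirror n 0 v) = - mirror n 0 (perp v)"
proof -
  have n: "n $ 1 * n $ 1 + n $ 2 * n $ 2 = 1" using assms by (simp add: inner_vec_def sum_2)
  show ?thesis
    unfolding vec_eq_iff forall_2
    using n by (simp add: perp_def mirror_def inner_vec_def sum_2) algebra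
qed

lemma plane_orthogonal_decomposition:
  "(e \<bullet> e) *\<^sub>R y = (y \<bullet> e) *\<^sub>R e + (y \<bullet> perp e) *\<^sub>R perp e"
  unfolding vec_eq_iff forall_2
  by (simp add: perp_def inner_vec_def sum_2) algebra

lemma mirror_uminus: "mirror (- n) (- c) = mirror n c"
  by (simp add: mirror_def fun_eq_iff flip: scaleR_minus_left)

text \<open>The normal is \<open>perp (w - z)\<close> normalized. The last property splits a point
  into its projection onto the line and its signed height, so that height 0 means lying on the
  line.\<close>

lemma reflect_eq_mirror:
  assumes "z \<noteq> w"
  obtains n where "n \<bullet> n = 1" "reflect z w = mirror n (z \<bullet> n)"
    "\<And>x. x = z + ((x - z) \<bullet> (w - z) / ((w - z) \<bullet> (w - z))) *\<^sub>R (w - z) + (x \<bullet> n - z \<bullet> n) *\<^sub>R n"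
proof
  define e where "e = w - z"
  have e: "e \<bullet> e > 0" using assms by (simp add: e_def)
  let ?n = "(1 / norm e) *\<^sub>R perp e"
  have pp: "perp e \<bullet> perp e = e \<bullet> e" by (simp add: perp_def inner_vec_def sum_2)
  have nn: "norm e * norm e = e \<bullet> e" by (simp add: power2_norm_eq_inner flip: power2_eq_square)
  show "?n \<bullet> ?n = 1" using e by (simp add: pp nn)
  show dec: "x = z + ((x - z) \<bullet> (w - z) / ((w - z) \<bullet> (w - z))) *\<^sub>R (w - z) + (x \<bullet> ?n - z \<bullet> ?n) *\<^sub>R ?n" for x
  proof -
    have "x - z = (1 / (e \<bullet> e)) *\<^sub>R ((e \<bullet> e) *\<^sub>R (x - z))" using e by simp
    also have "\<dots> = ((x - z) \<bullet> e / (e \<bullet> e)) *\<^sub>R e + ((x - z) \<bullet> perp e / (e \<bullet> e)) *\<^sub>R perp e"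
      by (simp only: plane_orthogonal_decomposition scaleR_add_right scaleR_scaleR) simp
    also have "((x - z) \<bullet> perp e / (e \<bullet> e)) *\<^sub>R perp e = (x \<bullet> ?n - z \<bullet> ?n) *\<^sub>R ?n"
      by (simp add: inner_diff_left diff_divide_distrib flip: nn)
    finally have "x - z = ((x - z) \<bullet> e / (e \<bullet> e)) *\<^sub>R e + (x \<bullet> ?n - z \<bullet> ?n) *\<^sub>R ?n" .
    from arg_cong[OF this, of "(+) z"] show ?thesis
      unfolding e_def[symmetric] add.assoc add_diff_cancel_left' by (simp only: diff_add_cancel add.commute[of z "x - z"])
  qed
  show "reflect z w = mirror ?n (z \<bullet> ?n)"
  proof
    fix x
    have "reflect z w x = 2 *\<^sub>R (x - (x \<bullet> ?n - z \<bullet> ?n) *\<^sub>R ?n) - x"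
      unfolding reflect_def using eq_diff_eq[THEN iffD2, OF dec[of x, symmetric]]
      by (rule arg_cong[where f = "\<lambda>y. 2 *\<^sub>R y - x"])
    then show "reflect z w x = mirror ?n (z \<bullet> ?n) x"
      by (simp add: mirror_def scaleR_2 algebra_simps)
  qed
qed

section \<open>Position of the domain relative to the line\<close>

lemma domain_off_line:
  fixes D :: "plane set"
  assumes D: "open D" "bounded D"
    and zw: "z \<noteq> w"
    and seg: "closed_segment z w \<subseteq> frontier D"
    and line: "frontier D \<inter> affine hull {z, w} = closed_segment z w"
  shows "z + t *\<^sub>R (w - z) \<notin> D"
proof
  define p where "p s = z + s *\<^sub>R (w - z)" for s :: real
  assume "z + t *\<^sub>R (w - z) \<in> D"
  then have pD: "p t \<in> D" by (simp add: p_def)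
  have hull: "p s \<in> affine hull {z, w}" for s
    unfolding affine_hull_2 p_def mem_Collect_eq
    by (intro exI[of _ "1 - s"] exI[of _ s]) (simp add: algebra_simps)
  have seg_iff: "p s \<in> closed_segment z w \<longleftrightarrow> 0 \<le> s \<and> s \<le> 1" for s
  proof
    assume "p s \<in> closed_segment z w"
    then obtain v where v: "0 \<le> v" "v \<le> 1" "p s = (1 - v) *\<^sub>R z + v *\<^sub>R w"
      by (auto simp: in_segment)
    then have "(s - v) *\<^sub>R (w - z) = 0" by (simp add: p_def algebra_simps)
    then show "0 \<le> s \<and> s \<le> 1" using v zw by simp
  next
    assume "0 \<le> s \<and> s \<le> 1"
    then show "p s \<in> closed_segment z w"
      unfolding in_segment p_def by (intro exI[of _ s]) (simp add: algebra_simps)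
  qed
  have fr: "p s \<in> frontier D \<Longrightarrow> 0 \<le> s \<and> s \<le> 1" for s
    using line hull[of s] seg_iff[of s] by blast
  have disj: "D \<inter> frontier D = {}"
    using D(1) by (auto simp: frontier_def interior_open)
  \<comment> \<open>The segment lies in the frontier, which an open set does not meet.\<close>
  have t: "t < 0 \<or> 1 < t"
  proof (rule ccontr)
    assume "\<not> (t < 0 \<or> 1 < t)"
    then have "p t \<in> closed_segment z w" using seg_iff[of t] by linarith
    then show False using pD seg disj by blast
  qed
  obtain B where B: "\<And>x. x \<in> D \<Longrightarrow> norm x \<le> B" using D(2) by (auto simp: bounded_iff)
  \<comment> \<open>Beyond this parameter the norm of \<open>p s\<close> exceeds the bound
    \<open>B\<close> on \<open>D\<close>.\<close>
  define L where "L = (B + norm z + 1) / norm (w - z)"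
  have out: "p s \<notin> D" if "\<bar>s\<bar> \<ge> L" for s
  proof
    assume "p s \<in> D"
    then have "norm (p s) \<le> B" by (rule B)
    moreover have "norm (s *\<^sub>R (w - z)) \<le> norm (p s) + norm z"
      using norm_triangle_ineq4[of "p s" z] by (simp add: p_def)
    moreover have "\<bar>s\<bar> * norm (w - z) \<ge> L * norm (w - z)"
      using that by (intro mult_right_mono) auto
    moreover have "L * norm (w - z) = B + norm z + 1" using zw by (simp add: L_def)
    ultimately show False by simp
  qed
  \<comment> \<open>Moving away from the segment keeps every parameter between \<open>t\<close> and
    \<open>s\<close> outside \<open>[0, 1]\<close>. The frontier is nevertheless crossed on the way
    out of \<open>D\<close>, which is the contradiction.\<close>
  define s where "s = (if 1 < t then t + \<bar>L\<bar> else t - \<bar>L\<bar>)"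
  have "p s \<notin> D" by (rule out) (use t in \<open>auto simp: s_def\<close>)
  then have "closed_segment (p t) (p s) \<inter> frontier D \<noteq> {}"
    using pD by (intro connected_Int_frontier) auto
  then obtain v where v: "0 \<le> v" "v \<le> 1" and vf: "(1 - v) *\<^sub>R p t + v *\<^sub>R p s \<in> frontier D"
    by (auto simp: in_segment)
  have "(1 - v) *\<^sub>R p t + v *\<^sub>R p s = p (t + v * (s - t))" by (simp add: p_def algebra_simps)
  with vf fr have "0 \<le> t + v * (s - t) \<and> t + v * (s - t) \<le> 1" by simp
  moreover have "v * \<bar>L\<bar> \<ge> 0" using v by simp
  ultimately show False using t by (auto simp: s_def split: if_splits)
qed

text \<open>A connected set meeting both sides of a hyperplane meets the hyperplane itself, which
  \<open>domain_off_line\<close> excludes.\<close>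

lemma domain_one_sided:
  fixes D :: "plane set"
  assumes D: "open D" "connected D" "bounded D"
    and zw: "z \<noteq> w"
    and seg: "closed_segment z w \<subseteq> frontier D"
    and line: "frontier D \<inter> affine hull {z, w} = closed_segment z w"
  obtains n c where "n \<bullet> n = 1" "reflect z w = mirror n c" "\<And>x. x \<in> D \<Longrightarrow> c < x \<bullet> n"
proof -
  obtain n where n: "n \<bullet> n = 1" "reflect z w = mirror n (z \<bullet> n)"
    and dec: "\<And>x. x = z + ((x - z) \<bullet> (w - z) / ((w - z) \<bullet> (w - z))) *\<^sub>R (w - z) + (x \<bullet> n - z \<bullet> n) *\<^sub>R n"
    by (fact reflect_eq_mirror[OF zw])
  define c where "c = z \<bullet> n"
  have off: "n \<bullet> x \<noteq> c" if "x \<in> D" for x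
  proof
    assume "n \<bullet> x = c"
    then have "x \<bullet> n - z \<bullet> n = 0" by (simp add: c_def inner_commute)
    then have eq: "z + ((x - z) \<bullet> (w - z) / ((w - z) \<bullet> (w - z))) *\<^sub>R (w - z) = x"
      using dec[of x, symmetric] unfolding \<open>x \<bullet> n - z \<bullet> n = 0\<close> scaleR_zero_left add_0_right by blast
    show False
      using domain_off_line[OF D(1,3) zw seg line, of "(x - z) \<bullet> (w - z) / ((w - z) \<bullet> (w - z))"] that
      unfolding eq by blast
  qed
  show thesis
  proof (cases "\<exists>x\<in>D. n \<bullet> x > c")
    case True
    then obtain y where y: "y \<in> D" "n \<bullet> y > c" by blast
    have "c < x \<bullet> n" if "x \<in> D" for x
    proof (rule ccontr)
      assume "\<not> c < x \<bullet> n"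
      then have "n \<bullet> x \<le> c" by (simp add: inner_commute)
      from connected_ivt_hyperplane[OF D(2) that y(1) this] y(2) off show False by auto
    qed
    then show thesis using that n by (simp add: c_def)
  next
    case False
    have "- c < x \<bullet> - n" if "x \<in> D" for x
      using False off[OF that] that by (auto simp: inner_commute not_less order.order_iff_strict)
    \<comment> \<open>Reversing the normal leaves the mirror unchanged and puts \<open>D\<close> on
      the positive side.\<close>
    then show thesis using that[of "- n" "- c"] n by (simp add: mirror_uminus c_def)
  qed
qed

text \<open>Strictly above the line the closure of the mirror image is absent, so the doubled domain
  there is an open subset of \<open>closure D\<close> and therefore lies in
  \<open>interior (closure D) = D\<close>. The lower half is treated by pulling it back through the
  mirror.\<close>

lemma doubled_domain_mirror:
  fixes D :: "plane set"
  assumes D: "open D" "interior (closure D) = D" and unit: "n \<bullet> n = 1"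
    and refl: "reflect z w = mirror n c"
    and side: "\<And>x. x \<in> D \<Longrightarrow> c < x \<bullet> n"
  shows "mirror_domain n c (doubled_domain D z w)"
    and "doubled_domain D z w \<inter> {x. c < x \<bullet> n} = D"
proof -
  let ?S = "mirror n c" and ?V = "doubled_domain D z w"
  note SS = mirror_mirror[OF unit, of c]
  have Sim: "?S ` A = ?S -` A" for A using mirror_image[OF unit, of _ c A] by auto
  have h: "?S x \<bullet> n = 2 * c - x \<bullet> n" for x using mirror_height[OF unit, of c x] by simp
  have V: "?V = interior (closure D \<union> closure (?S ` D))" by (simp add: doubled_domain_def refl)
  have opS: "open (?S -` A)" if "open A" for A
    using that by (rule open_vimage) (rule continuous_on_mirror)
  have 1: "D \<subseteq> ?V" unfolding V
    using D(1) closure_subset by (intro interior_maximal) auto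
  have 2: "?S ` D \<subseteq> ?V" unfolding V
  proof (rule interior_maximal)
    show "open (?S ` D)" unfolding Sim by (rule opS[OF D(1)])
    show "?S ` D \<subseteq> closure D \<union> closure (?S ` D)" using closure_subset[of "?S ` D"] by blast
  qed
  have cl1: "closure D \<subseteq> {x. c \<le> x \<bullet> n}"
    using side by (intro closure_minimal closed_Collect_le continuous_intros) (auto intro: less_imp_le)
  have cl2: "closure (?S ` D) \<subseteq> {x. x \<bullet> n \<le> c}"
    using side by (intro closure_minimal closed_Collect_le continuous_intros) (auto simp: h intro: less_imp_le)
  have cl3: "closure (?S ` D) \<subseteq> ?S -` closure D"
  proof (rule closure_minimal)
    show "?S ` D \<subseteq> ?S -` closure D" using closure_subset SS by auto
    show "closed (?S -` closure D)" by (intro closed_vimage continuous_on_mirror) auto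
  qed
  have opV: "open ?V" by (simp add: V)
  have Vsub: "?V \<subseteq> closure D \<union> closure (?S ` D)" unfolding V by (rule interior_subset)
  have 3: "?V \<inter> {x. c < x \<bullet> n} \<subseteq> D"
  proof -
    have "open (?V \<inter> {x. c < x \<bullet> n})"
      by (intro open_Int opV open_Collect_less continuous_intros)
    moreover have "?V \<inter> {x. c < x \<bullet> n} \<subseteq> closure D" using Vsub cl2 by force
    ultimately have "?V \<inter> {x. c < x \<bullet> n} \<subseteq> interior (closure D)" by (rule interior_maximal[rotated])
    then show ?thesis using D(2) by simp
  qed
  have 4: "?S -` (?V \<inter> {x. x \<bullet> n < c}) \<subseteq> D"
  proof -
    have "open (?S -` (?V \<inter> {x. x \<bullet> n < c}))"
      by (intro opS open_Int opV open_Collect_less continuous_intros)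
    moreover have "?S -` (?V \<inter> {x. x \<bullet> n < c}) \<subseteq> closure D"
    proof
      fix x assume "x \<in> ?S -` (?V \<inter> {x. x \<bullet> n < c})"
      then have "?S x \<in> closure (?S ` D)" using Vsub cl1 by force
      then have "?S (?S x) \<in> closure D" using cl3 by blast
      then show "x \<in> closure D" by (simp add: SS)
    qed
    ultimately have "?S -` (?V \<inter> {x. x \<bullet> n < c}) \<subseteq> interior (closure D)" by (rule interior_maximal[rotated])
    then show ?thesis using D(2) by simp
  qed
  show "?V \<inter> {x. c < x \<bullet> n} = D" using 1 3 side by auto
  show "mirror_domain n c ?V"
  proof
    show "n \<bullet> n = 1" by (rule unit)
    show "distr lborel borel ?S = lborel" by (rule lborel_distr_mirror_plane[OF unit])
    show "open ?V" by (rule opV)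
    fix x assume x: "x \<in> ?V" "x \<bullet> n \<noteq> c"
    show "?S x \<in> ?V"
    proof (cases "c < x \<bullet> n")
      case True
      then show ?thesis using x 2 3 by blast
    next
      case False
      then have "?S x \<in> ?S -` (?V \<inter> {x. x \<bullet> n < c})" using x by (simp add: SS)
      then show ?thesis using 1 4 by blast
    qed
  qed
qed

section \<open>Space-time form of the transport equation\<close>

text \<open>The transport integrand is the derivative of the test function along the flux
  \<open>a * (1, v)\<close>; this brings the equation into the form of the general reflection
  theorem.\<close>

lemma spacetime_pairing:
  fixes \<eta> :: "real \<times> plane \<Rightarrow> real"
  assumes \<eta>: "\<eta> \<in> test_functions W"
  shows "frechet_derivative \<eta> (at (t, x)) (a, a *\<^sub>R v) =
    a * (deriv (\<lambda>s. \<eta> (s, x)) t + v \<bullet> grad (\<lambda>y. \<eta> (t, y)) x)"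
proof -
  let ?D = "frechet_derivative \<eta> (at (t, x))"
  note d = test_functions_has_derivative[OF \<eta>, of "(t, x)"]
  have lin: "linear ?D" by (rule has_derivative_linear[OF d])
  have "((\<lambda>s. (s, x)) has_derivative (\<lambda>s. (s, 0))) (at t)" by (auto intro!: derivative_eq_intros)
  from has_derivative_compose[OF this d]
  have "((\<lambda>s. \<eta> (s, x)) has_derivative (\<lambda>s. ?D (s, 0))) (at t)" .
  moreover have "(\<lambda>s. ?D (s, 0)) = (*) (?D (1, 0))"
  proof
    fix s show "?D (s, 0) = ?D (1, 0) * s"
      using linear_scale[OF lin, of s "(1, 0)"] by (simp add: mult.commute)
  qed
  ultimately have t: "deriv (\<lambda>s. \<eta> (s, x)) t = ?D (1, 0)"
    by (intro DERIV_imp_deriv) (simp add: has_field_derivative_def)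
  have "((\<lambda>y. (t, y)) has_derivative (\<lambda>y. (0, y))) (at x)" by (auto intro!: derivative_eq_intros)
  from has_derivative_compose[OF this d]
  have y: "((\<lambda>y. \<eta> (t, y)) has_derivative (\<lambda>y. ?D (0, y))) (at x)" .
  then have "(\<lambda>y. \<eta> (t, y)) differentiable (at x)" by (auto simp: differentiable_def)
  from grad_inner[OF this] have g: "v \<bullet> grad (\<lambda>y. \<eta> (t, y)) x = ?D (0, v)"
    unfolding frechet_derivative_at[OF y, symmetric] .
  have "?D (a, a *\<^sub>R v) = ?D (a *\<^sub>R ((1, 0) + (0, v)))" by simp
  also have "\<dots> = a * (?D (1, 0) + ?D (0, v))"
    by (simp only: linear_scale[OF lin] linear_add[OF lin] real_scaleR_def)
  finally show ?thesis by (simp add: t g)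
qed

section \<open>Odd extension of Euler solutions\<close>

lemma norm_sq_integrable_imp_set_integrable:
  fixes g :: "'a::euclidean_space \<Rightarrow> 'b::euclidean_space"
  assumes D: "open D" "bounded D"
    and g: "g \<in> borel_measurable (lebesgue_on D)" "integrable (lebesgue_on D) (\<lambda>x. (norm (g x))\<^sup>2)"
  shows "integrable (lebesgue_on D) (\<lambda>x. k :: real)" and "set_integrable lebesgue (D \<inter> cball 0 r) g"
proof -
  have Dl: "D \<in> sets lebesgue" using D by simp
  have "D \<in> lmeasurable" using D by (simp add: bounded_set_imp_lmeasurable)
  then have "emeasure lebesgue D < \<infinity>" unfolding fmeasurable_def by blast
  then show c: "integrable (lebesgue_on D) (\<lambda>x. k)" for k :: real
    using Dl by (simp add: integrable_restrict_space)
  have "integrable (lebesgue_on D) g"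
  proof (rule Bochner_Integration.integrable_bound[OF Bochner_Integration.integrable_add[OF c g(2)] g(1)])
    have "norm y \<le> 1 + (norm y)\<^sup>2" for y :: 'b
      using zero_le_power2[of "norm y - 1 / 2"] by (simp add: power2_diff power2_eq_square algebra_simps)
    then show "AE x in lebesgue_on D. norm (g x) \<le> norm (1 + (norm (g x))\<^sup>2)" by simp
  qed
  then have "set_integrable lebesgue D g"
    using Dl by (simp add: integrable_restrict_space set_integrable_def)
  then show "set_integrable lebesgue (D \<inter> cball 0 r) g"
    by (rule set_integrable_subset) (use Dl in auto)
qed

text \<open>Membership in \<open>H10\<close> follows by reflecting the approximating test functions
  oddly: they vanish near the line already. The equation must be tested against functions that do
  not vanish near the line, and for it the general reflection theorem is used.\<close>

lemma dirichlet_solution_reflected: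
  fixes n :: plane
  assumes "mirror_domain n c V" and U: "V \<inter> {x. c < x \<bullet> n} = D"
    and D: "D \<subseteq> cball 0 r" "r > 0"
    and sol: "dirichlet_solution D f \<psi> g"
    and f: "f \<in> borel_measurable (lebesgue_on D)" "AE x in lebesgue_on D. \<bar>f x\<bar> \<le> M"
    and f': "\<And>x. x \<in> D \<Longrightarrow> f' x = f x" "\<And>x. x \<in> D \<Longrightarrow> f' (mirror n c x) = - f x"
    and \<psi>': "\<And>x. x \<in> D \<Longrightarrow> \<psi>' x = \<psi> x" "\<And>x. x \<in> D \<Longrightarrow> \<psi>' (mirror n c x) = - \<psi> x"
    and g': "\<And>x. x \<in> D \<Longrightarrow> g' x = g x" "\<And>x. x \<in> D \<Longrightarrow> g' (mirror n c x) = - mirror n 0 (g x)"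
  shows "dirichlet_solution V f' \<psi>' g'"
proof -
  interpret mirror_domain n c V by fact
  have UD: "U = D" unfolding U_def by (rule U)
  note open_D = open_U[unfolded UD] and D_leb = U_lebesgue[unfolded UD]
  have bD: "bounded D" using D(1) bounded_cball bounded_subset by blast
  have lower: "S x \<notin> D" if "x \<in> D" for x using not_both[of x] that by (simp add: UD)
  note energy = dirichlet_energy_bound[OF sol open_D D f]
  have \<psi>m: "\<psi> \<in> borel_measurable (lebesgue_on D)" and gm: "g \<in> borel_measurable (lebesgue_on D)"
    using sol by (auto simp: dirichlet_solution_def H10_def)
  note c = norm_sq_integrable_imp_set_integrable(1)[OF open_D bD gm energy(1)]
  have Rm: "(\<lambda>x. R (g x)) \<in> borel_measurable (lebesgue_on D)"
    by (rule measurable_compose[OF gm borel_measurable_mirror])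
  have cong: "(\<And>x. x \<in> D \<Longrightarrow> a x = b x) \<Longrightarrow> b \<in> borel_measurable (lebesgue_on D) \<Longrightarrow> a \<in> borel_measurable (lebesgue_on D)"
    for a b :: "plane \<Rightarrow> 'b::topological_space"
    using measurable_cong[of "lebesgue_on D" a b] by simp
  have \<psi>'m: "\<psi>' \<in> borel_measurable (lebesgue_on V)"
    by (rule measurable_VI; unfold UD)
       (rule cong[OF \<psi>'(1)] cong[OF \<psi>'(2)] \<psi>m borel_measurable_uminus | assumption)+
  have g'm: "g' \<in> borel_measurable (lebesgue_on V)"
    by (rule measurable_VI; unfold UD)
       (rule cong[OF g'(1)] cong[OF g'(2)] gm Rm borel_measurable_uminus | assumption)+
  obtain \<Phi> where \<Phi>: "\<And>k. \<Phi> k \<in> test_functions D"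
      "(\<lambda>k::nat. \<integral>\<^sup>+x. ennreal ((\<Phi> k x - \<psi> x)\<^sup>2) \<partial>lebesgue_on D) \<longlonglongrightarrow> 0"
      "(\<lambda>k::nat. \<integral>\<^sup>+x. ennreal ((norm (grad (\<Phi> k) x - g x))\<^sup>2) \<partial>lebesgue_on D) \<longlonglongrightarrow> 0"
    using sol unfolding dirichlet_solution_def H10_def by blast
  \<comment> \<open>Each \<open>\<Phi> k\<close> has compact support in \<open>D\<close>, so at any
    point at most one of the two terms is nonzero.\<close>
  define \<Psi> where "\<Psi> k = (\<lambda>x. \<Phi> k x - \<Phi> k (S x))" for k
  have \<Psi>t: "\<Psi> k \<in> test_functions (D \<union> S ` D)" for k
    unfolding \<Psi>_def by (rule odd_part_test_function[OF \<Phi>(1)])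
  have \<Psi>V: "\<Psi> k \<in> test_functions V" for k
    by (rule test_functions_mono[OF \<Psi>t]) (use S_U_subset_V UD U in auto)
  have vanish: "\<Phi> k x = 0" "frechet_derivative (\<Phi> k) (at x) v = 0" if "x \<notin> D" for k x v
  proof -
    obtain K where K: "compact K" "K \<subseteq> D" "\<And>x. x \<notin> K \<Longrightarrow> \<Phi> k x = 0"
      "\<And>x v. x \<notin> K \<Longrightarrow> frechet_derivative (\<Phi> k) (at x) v = 0"
      by (fact test_functions_support[OF \<Phi>(1)])
    have "x \<notin> K" using that K(2) by blast
    then show "\<Phi> k x = 0" "frechet_derivative (\<Phi> k) (at x) v = 0" by (rule K(3), rule K(4))
  qed
  have \<Psi>1: "\<Psi> k x = \<Phi> k x" and \<Psi>2: "\<Psi> k (S x) = - \<Phi> k x" if "x \<in> D" for k x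
    using vanish(1)[OF lower[OF that]] by (auto simp: \<Psi>_def S_S)
  have D\<Psi>: "v \<bullet> grad (\<Psi> k) x = frechet_derivative (\<Phi> k) (at x) v - frechet_derivative (\<Phi> k) (at (S x)) (R v)" for k x v
    unfolding test_functions_grad[OF \<Psi>t] unfolding \<Psi>_def odd_part_derivative[OF \<Phi>(1)] by (rule refl)
  have g1: "grad (\<Psi> k) x = grad (\<Phi> k) x" if "x \<in> D" for k x
    by (rule vector_eq_ldot[THEN iffD1])
       (simp add: D\<Psi> vanish(2)[OF lower[OF that]] test_functions_grad[OF \<Phi>(1)])
  have g2: "grad (\<Psi> k) (S x) = - R (grad (\<Phi> k) x)" if "x \<in> D" for k x
    by (rule vector_eq_ldot[THEN iffD1])
       (simp add: D\<Psi> S_S vanish(2)[OF lower[OF that]] test_functions_grad[OF \<Phi>(1)] flip: mirror_inner)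
  have n2: "norm (grad (\<Psi> k) (S x) - g' (S x)) = norm (grad (\<Phi> k) x - g x)" if "x \<in> D" for k x
  proof -
    have "grad (\<Psi> k) (S x) - g' (S x) = - R (grad (\<Phi> k) x - g x)"
      using that by (simp add: g2 g' linear_diff[OF linear_mirror])
    then show ?thesis by (simp add: norm_mirror[OF unit])
  qed
  have m1: "(\<lambda>x. ennreal ((\<Phi> k x - \<psi> x)\<^sup>2)) \<in> borel_measurable (lebesgue_on D)" for k
  proof -
    have "\<Phi> k \<in> borel_measurable (lebesgue_on D)"
      using test_functions_integral_on(1)[OF \<Phi>(1) D_leb] by auto
    then show ?thesis using \<psi>m by measurable
  qed
  have m2: "(\<lambda>x. ennreal ((norm (grad (\<Phi> k) x - g x))\<^sup>2)) \<in> borel_measurable (lebesgue_on D)" for k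
    using test_functions_grad_measurable[OF \<Phi>(1) D_leb, of k] gm by measurable
  \<comment> \<open>The mirror is an isometry, so both halves carry the same approximation
    error.\<close>
  have double: "(\<integral>\<^sup>+x. a x \<partial>lebesgue_on V) = (\<integral>\<^sup>+x. b x \<partial>lebesgue_on D) + (\<integral>\<^sup>+x. b x \<partial>lebesgue_on D)"
    if b: "b \<in> borel_measurable (lebesgue_on D)"
      and ab: "\<And>x. x \<in> D \<Longrightarrow> a x = b x" "\<And>x. x \<in> D \<Longrightarrow> a (S x) = b x" for a b :: "plane \<Rightarrow> ennreal"
  proof -
    have "(\<integral>\<^sup>+x. a x \<partial>lebesgue_on V) = (\<integral>\<^sup>+x. a x \<partial>lebesgue_on D) + (\<integral>\<^sup>+x. a (S x) \<partial>lebesgue_on D)"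
      using nn_integral_V[of a] cong[OF ab(1) b] cong[OF ab(2) b] by (simp add: UD)
    also have "(\<integral>\<^sup>+x. a x \<partial>lebesgue_on D) = (\<integral>\<^sup>+x. b x \<partial>lebesgue_on D)"
      by (rule nn_integral_cong) (simp add: ab)
    also have "(\<integral>\<^sup>+x. a (S x) \<partial>lebesgue_on D) = (\<integral>\<^sup>+x. b x \<partial>lebesgue_on D)"
      by (rule nn_integral_cong) (simp add: ab)
    finally show ?thesis .
  qed
  have l1: "(\<lambda>k. \<integral>\<^sup>+x. ennreal ((\<Psi> k x - \<psi>' x)\<^sup>2) \<partial>lebesgue_on V) \<longlonglongrightarrow> 0"
  proof -
    have "(\<integral>\<^sup>+x. ennreal ((\<Psi> k x - \<psi>' x)\<^sup>2) \<partial>lebesgue_on V) =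
        (\<integral>\<^sup>+x. ennreal ((\<Phi> k x - \<psi> x)\<^sup>2) \<partial>lebesgue_on D) + (\<integral>\<^sup>+x. ennreal ((\<Phi> k x - \<psi> x)\<^sup>2) \<partial>lebesgue_on D)" for k
      by (rule double[OF m1]) (simp_all add: \<Psi>1 \<Psi>2 \<psi>' power2_commute)
    then show ?thesis using tendsto_add[OF \<Phi>(2) \<Phi>(2)] by simp
  qed
  have l2: "(\<lambda>k. \<integral>\<^sup>+x. ennreal ((norm (grad (\<Psi> k) x - g' x))\<^sup>2) \<partial>lebesgue_on V) \<longlonglongrightarrow> 0"
  proof -
    have "(\<integral>\<^sup>+x. ennreal ((norm (grad (\<Psi> k) x - g' x))\<^sup>2) \<partial>lebesgue_on V) =
        (\<integral>\<^sup>+x. ennreal ((norm (grad (\<Phi> k) x - g x))\<^sup>2) \<partial>lebesgue_on D) + (\<integral>\<^sup>+x. ennreal ((norm (grad (\<Phi> k) x - g x))\<^sup>2) \<partial>lebesgue_on D)" for k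
      by (rule double[OF m2]) (simp_all only: g1 n2 g'(1))
    then show ?thesis using tendsto_add[OF \<Phi>(3) \<Phi>(3)] by simp
  qed
  have H: "H10 V \<psi>' g'"
    unfolding H10_def using \<psi>'m g'm \<Psi>V l1 l2 by blast
  have gi: "set_integrable lebesgue (U \<inter> cball 0 \<rho>) g" for \<rho>
    unfolding UD by (rule norm_sq_integrable_imp_set_integrable(2)[OF open_D bD gm energy(1)])
  have fi: "integrable (lebesgue_on D) f"
    by (rule Bochner_Integration.integrable_bound[OF c[where k = M] f(1)], use f(2) in eventually_elim) (auto intro: order_trans)
  have fs: "set_integrable lebesgue (U \<inter> cball 0 \<rho>) f" for \<rho>
    unfolding UD
    by (rule set_integrable_subset[of _ D]) (use fi D_leb in \<open>auto simp: set_integrable_def integrable_restrict_space\<close>)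
  have gi': "set_integrable lebesgue (D \<inter> cball 0 \<rho>) g" and fs': "set_integrable lebesgue (D \<inter> cball 0 \<rho>) f" for \<rho>
    using gi fs by (simp_all add: UD)
  \<comment> \<open>The Dirichlet equation with both terms moved to one side, the form required by
    the reflection theorem.\<close>
  have weak: "(LINT x|lebesgue_on U. frechet_derivative \<eta> (at x) (g x) + f x * \<eta> x) = 0" if "\<eta> \<in> test_functions U" for \<eta>
  proof -
    have \<eta>: "\<eta> \<in> test_functions D" using that by (simp add: UD)
    have "(LINT x|lebesgue_on D. frechet_derivative \<eta> (at x) (g x) + f x * \<eta> x) =
       (LINT x|lebesgue_on D. frechet_derivative \<eta> (at x) (g x)) + (LINT x|lebesgue_on D. f x * \<eta> x)"
      by (intro Bochner_Integration.integral_add integrable_derivative_pairing[OF \<eta> D_leb gi']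
          integrable_function_pairing[OF \<eta> D_leb fs'])
    also have "(LINT x|lebesgue_on D. frechet_derivative \<eta> (at x) (g x)) = - (LINT x|lebesgue_on D. f x * \<eta> x)"
      using sol \<eta> unfolding dirichlet_solution_def test_functions_grad[OF \<eta>, symmetric] by blast
    finally show ?thesis by (simp add: UD)
  qed
  have "(LINT x|lebesgue_on V. g' x \<bullet> grad \<phi> x) = - (LINT x|lebesgue_on V. f' x * \<phi> x)"
    if \<phi>: "\<phi> \<in> test_functions V" for \<phi>
  proof -
    note rel = g'[folded UD] f'[folded UD]
    note W = weak_identity_reflected[where F = g and F' = g' and f = f and f' = f', OF gi fs weak rel \<phi>]
    show ?thesis
      using Bochner_Integration.integral_add[OF W(1,2)] W(3) by (simp add: test_functions_grad[OF \<phi>])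
  qed
  then show ?thesis unfolding dirichlet_solution_def using H by blast
qed

lemma perp_minus: "perp (- v) = - perp v"
  by (simp add: perp_def vec_eq_iff forall_2)

section \<open>Vorticity, velocity and patches on the doubled domain\<close>

text \<open>The line enters only through a unit normal pointing towards \<open>D\<close>. The mirror
  theory is instantiated twice: \<open>P\<close> in the plane for the Dirichlet problem,
  \<open>T\<close> in space-time for the transport equation.\<close>

locale doubled_plane =
  fixes D :: "plane set" and z w n :: plane and c :: real
  assumes open_D: "open D" and bounded_D: "bounded D" and regular: "interior (closure D) = D"
    and unit: "n \<bullet> n = 1" and reflect_eq: "reflect z w = mirror n c"
    and side: "\<And>x. x \<in> D \<Longrightarrow> c < x \<bullet> n"
begin

abbreviation V :: "plane set" where "V \<equiv> doubled_domain D z w"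

abbreviation S :: "plane \<Rightarrow> plane" where "S \<equiv> mirror n c"

sublocale P: mirror_domain n c V
  by (rule doubled_domain_mirror[OF open_D regular unit reflect_eq side])

lemma P_U: "P.U = D"
  unfolding P.U_def by (rule doubled_domain_mirror[OF open_D regular unit reflect_eq side])

sublocale T: mirror_domain "(0 :: real, n)" c "UNIV \<times> V"
proof
  show "(0 :: real, n) \<bullet> (0, n) = 1" by (simp add: unit)
  show "distr lborel borel (mirror (0 :: real, n) c) = lborel"
    by (rule lborel_distr_mirror_time[OF P.preserving])
  show "open ((UNIV :: real set) \<times> V)" by (intro open_Times P.open_V) simp
  fix p :: "real \<times> plane" assume "p \<in> UNIV \<times> V" "p \<bullet> (0, n) \<noteq> c"
  then show "mirror (0, n) c p \<in> UNIV \<times> V"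
    by (cases p) (auto simp: mirror_time P.symmetric)
qed

lemma T_U: "T.U = UNIV \<times> D"
proof -
  have "x \<in> D \<longleftrightarrow> x \<in> V \<and> c < x \<bullet> n" for x
    using P_U unfolding P.U_def by blast
  then have "(t, x) \<in> T.U \<longleftrightarrow> (t, x) \<in> UNIV \<times> D" for t x
    unfolding T.U_def by (simp only: mem_Times_iff Int_iff mem_Collect_eq fst_conv snd_conv inner_Pair inner_zero_right add_0 UNIV_I simp_thms)
  then show ?thesis by (intro set_eqI) (metis surj_pair)
qed

lemma D_leb: "D \<in> sets lebesgue" using open_D by simp

lemma D_subset_V: "D \<subseteq> V"
  using P_U unfolding P.U_def by blast

lemma S_D_subset_V: "S ` D \<subseteq> V"
  using P.S_U_subset_V unfolding P_U .

lemma S_notin_D: "x \<in> D \<Longrightarrow> S x \<notin> D"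
  using P.not_both unfolding P_U .

lemma S_mem_S_D: "S x \<in> S ` A \<longleftrightarrow> x \<in> A"
  by (simp add: mirror_image[OF unit] P.S_S)

lemma odd_extension_upper: "x \<in> D \<Longrightarrow> odd_extension D z w \<omega> t x = \<omega> t x"
  by (simp add: odd_extension_def)

lemma odd_extension_lower: "x \<in> D \<Longrightarrow> odd_extension D z w \<omega> t (S x) = - \<omega> t x"
  using S_notin_D by (simp add: odd_extension_def reflect_eq P.S_S)

text \<open>Almost-everywhere facts about the extension (bound, support, velocity, period, patch)
  all come from a fact on \<open>D\<close> read at \<open>x\<close> and at
  \<open>S x\<close>.\<close>

lemma AE_VI:
  assumes "AE x in lebesgue_on D. P x"
    and "\<And>x. x \<in> D \<Longrightarrow> P x \<Longrightarrow> Q x \<and> Q (S x)"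
  shows "AE x in lebesgue_on V. Q x"
proof -
  have 1: "AE x in lebesgue. x \<in> D \<longrightarrow> P x" using assms(1) D_leb by (simp add: AE_restrict_space_iff)
  have "AE x in lebesgue. x \<in> D \<longrightarrow> Q x" "AE x in lebesgue. x \<in> D \<longrightarrow> Q (S x)"
    using 1 by (eventually_elim, use assms(2) in blast)+
  then show ?thesis using D_leb by (intro P.AE_VI) (simp_all add: P_U AE_restrict_space_iff)
qed

lemma measurable_upper_cong:
  "(\<And>x. x \<in> A \<Longrightarrow> f x = g x) \<Longrightarrow> g \<in> borel_measurable (lebesgue_on A) \<Longrightarrow> f \<in> borel_measurable (lebesgue_on A)"
  using measurable_cong[of "lebesgue_on A" f g] by simp

lemma measurable_VI:
  fixes f g h :: "plane \<Rightarrow> 'b::euclidean_space"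
  assumes "\<And>x. x \<in> D \<Longrightarrow> f x = g x" "g \<in> borel_measurable (lebesgue_on D)"
    and "\<And>x. x \<in> D \<Longrightarrow> f (S x) = h x" "h \<in> borel_measurable (lebesgue_on D)"
  shows "f \<in> borel_measurable (lebesgue_on V)"
  using measurable_upper_cong[OF assms(1,2)] measurable_upper_cong[OF assms(3,4)]
  by (intro P.measurable_VI) (simp_all add: P_U)

lemma measurable_spacetime_VI:
  fixes f g h :: "real \<Rightarrow> plane \<Rightarrow> 'b::euclidean_space"
  assumes fg: "\<And>t x. x \<in> D \<Longrightarrow> f t x = g t x"
    and g: "(\<lambda>(t, x). g t x) \<in> borel_measurable (lebesgue_on (UNIV \<times> D))"
    and fh: "\<And>t x. x \<in> D \<Longrightarrow> f t (S x) = h t x"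
    and h: "(\<lambda>(t, x). h t x) \<in> borel_measurable (lebesgue_on (UNIV \<times> D))"
  shows "(\<lambda>(t, x). f t x) \<in> borel_measurable (lebesgue_on (UNIV \<times> V))"
proof (rule T.measurable_VI; unfold T_U)
  show "(\<lambda>(t, x). f t x) \<in> borel_measurable (lebesgue_on (UNIV \<times> D))"
    by (rule measurable_upper_cong[OF _ g]) (auto simp: fg)
  show "(\<lambda>p. case mirror (0, n) c p of (t, x) \<Rightarrow> f t x) \<in> borel_measurable (lebesgue_on (UNIV \<times> D))"
    by (rule measurable_upper_cong[OF _ h]) (auto simp: mirror_time fh)
qed

lemma odd_extension_Linf_c:
  assumes "\<omega> t \<in> Linf_c D"
  shows "odd_extension D z w \<omega> t \<in> Linf_c V"
proof -
  let ?W = "odd_extension D z w \<omega> t"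
  obtain M K where m: "\<omega> t \<in> borel_measurable (lebesgue_on D)"
    and M: "AE x in lebesgue_on D. \<bar>\<omega> t x\<bar> \<le> M"
    and K: "compact K" "K \<subseteq> D" "AE x in lebesgue_on D. x \<notin> K \<longrightarrow> \<omega> t x = 0"
    using assms unfolding Linf_c_def by blast
  have "?W \<in> borel_measurable (lebesgue_on V)"
    by (rule measurable_VI[where g = "\<omega> t" and h = "\<lambda>x. - \<omega> t x"])
      (use m in \<open>auto simp: odd_extension_upper odd_extension_lower\<close>)
  moreover have "AE x in lebesgue_on V. \<bar>?W x\<bar> \<le> M"
    by (rule AE_VI[OF M]) (simp add: odd_extension_upper odd_extension_lower)
  moreover have "compact (K \<union> S ` K)"
    by (intro compact_Un K compact_continuous_image continuous_on_mirror)
  moreover have "K \<union> S ` K \<subseteq> V" using K(2) D_subset_V S_D_subset_V by blast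
  moreover have "AE x in lebesgue_on V. x \<notin> K \<union> S ` K \<longrightarrow> ?W x = 0"
    by (rule AE_VI[OF K(3)]) (auto simp: odd_extension_upper odd_extension_lower S_mem_S_D)
  ultimately show ?thesis unfolding Linf_c_def by blast
qed

lemma odd_extension_Linf_Linf_c:
  assumes "\<omega> \<in> Linf_Linf_c D"
  shows "odd_extension D z w \<omega> \<in> Linf_Linf_c V"
proof -
  let ?W = "odd_extension D z w \<omega>"
  obtain M where m: "(\<lambda>(t, x). \<omega> t x) \<in> borel_measurable (lebesgue_on (UNIV \<times> D))"
    and c: "AE t in lebesgue. \<omega> t \<in> Linf_c D"
    and M: "AE t in lebesgue. AE x in lebesgue_on D. \<bar>\<omega> t x\<bar> \<le> M"
    using assms unfolding Linf_Linf_c_def by blast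
  have hm: "(\<lambda>(t, x). - \<omega> t x) \<in> borel_measurable (lebesgue_on (UNIV \<times> D))"
    using borel_measurable_uminus[OF m] by (simp add: case_prod_beta)
  have "(\<lambda>(t, x). ?W t x) \<in> borel_measurable (lebesgue_on (UNIV \<times> V))"
    by (rule measurable_spacetime_VI[where f = ?W, OF _ m _ hm]) (simp_all add: odd_extension_upper odd_extension_lower)
  moreover have "AE t in lebesgue. ?W t \<in> Linf_c V"
    using c by eventually_elim (rule odd_extension_Linf_c)
  moreover have "AE t in lebesgue. AE x in lebesgue_on V. \<bar>?W t x\<bar> \<le> M"
    using M by eventually_elim (erule AE_VI, simp add: odd_extension_upper odd_extension_lower)
  ultimately show ?thesis unfolding Linf_Linf_c_def by blast
qed

lemma bounded_V: "bounded V"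
proof -
  have "compact (S ` closure D)"
    using bounded_D by (intro compact_continuous_image continuous_on_mirror) simp
  moreover have "S ` D \<subseteq> S ` closure D" using closure_subset by auto
  ultimately have "closure (S ` D) \<subseteq> S ` closure D"
    by (intro closure_minimal compact_imp_closed)
  then have "bounded (closure (S ` D))"
    using \<open>compact (S ` closure D)\<close> compact_imp_bounded bounded_subset by blast
  then have "bounded (closure D \<union> closure (S ` D))" using bounded_closure[OF bounded_D] by simp
  then show ?thesis
    unfolding doubled_domain_def reflect_eq by (rule bounded_subset[OF _ interior_subset])
qed

lemma time_periodic_odd_extension:
  assumes "time_periodic D \<omega>"
  shows "time_periodic V (odd_extension D z w \<omega>)"
proof -
  let ?W = "odd_extension D z w \<omega>"
  obtain p where p: "p > 0" and eq: "AE t in lebesgue. AE x in lebesgue_on D. \<omega> (t + p) x = \<omega> t x"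
    using assms unfolding time_periodic_def by blast
  have "AE t in lebesgue. AE x in lebesgue_on V. ?W (t + p) x = ?W t x"
    using eq by eventually_elim (erule AE_VI, simp add: odd_extension_upper odd_extension_lower)
  then show ?thesis unfolding time_periodic_def using p by blast
qed

text \<open>The velocity is reflected without a sign and the vorticity with one, so the flux
  \<open>(\<omega>, \<omega> u)\<close> obeys the sign rule of the reflection theorem. The reflected
  velocity is also the one generated by the extended vorticity, by the Dirichlet problem at almost
  every time.\<close>

lemma euler_odd_extension:
  assumes "global_weak_euler D \<omega>"
  shows "global_weak_euler V (odd_extension D z w \<omega>)"
proof -
  let ?W = "odd_extension D z w \<omega>" and ?R = "mirror n 0"
  obtain u where \<omega>: "\<omega> \<in> Linf_Linf_c D"
    and um: "(\<lambda>(t, x). u t x) \<in> borel_measurable (lebesgue_on (UNIV \<times> D))"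
    and vel: "AE t in lebesgue. velocity_of D (\<omega> t) (u t)"
    and weak: "\<And>\<phi>. \<phi> \<in> test_functions (UNIV \<times> D) \<Longrightarrow>
      (LINT (t, x)|lebesgue_on (UNIV \<times> D).
        \<omega> t x * (deriv (\<lambda>s. \<phi> (s, x)) t + u t x \<bullet> grad (\<lambda>y. \<phi> (t, y)) x)) = 0"
    using assms unfolding global_weak_euler_def by blast
  obtain M0 where m: "(\<lambda>(t, x). \<omega> t x) \<in> borel_measurable (lebesgue_on (UNIV \<times> D))"
    and c: "AE t in lebesgue. \<omega> t \<in> Linf_c D"
    and M0: "AE t in lebesgue. AE x in lebesgue_on D. \<bar>\<omega> t x\<bar> \<le> M0"
    using \<omega> unfolding Linf_Linf_c_def by blast
  \<comment> \<open>The absolute value makes the bound nonnegative, as the monotonicity steps below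
    require.\<close>
  define M where "M = \<bar>M0\<bar>"
  have M: "AE t in lebesgue. AE x in lebesgue_on D. \<bar>\<omega> t x\<bar> \<le> M"
    using M0 by eventually_elim (auto simp: M_def elim!: eventually_mono)
  obtain r where r: "D \<subseteq> cball 0 r" "r > 0"
  proof -
    obtain B where "B > 0" "\<forall>x\<in>D. norm x \<le> B" using bounded_D unfolding bounded_pos by blast
    then show thesis by (intro that[of B]) auto
  qed
  define u' where "u' t x = (if x \<in> D then u t x else if S x \<in> D then ?R (u t (S x)) else 0)" for t x
  have u'1: "u' t x = u t x" and u'2: "u' t (S x) = ?R (u t x)" if "x \<in> D" for t x
    using that S_notin_D[OF that] by (auto simp: u'_def P.S_S)
  have "(\<lambda>p. ?R ((\<lambda>(t, x). u t x) p)) \<in> borel_measurable (lebesgue_on (UNIV \<times> D))"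
    by (rule measurable_compose[OF um borel_measurable_mirror])
  then have hm: "(\<lambda>(t, x). ?R (u t x)) \<in> borel_measurable (lebesgue_on (UNIV \<times> D))"
    by (simp add: case_prod_beta)
  have u'm: "(\<lambda>(t, x). u' t x) \<in> borel_measurable (lebesgue_on (UNIV \<times> V))"
    by (rule measurable_spacetime_VI[where f = u', OF u'1 um u'2 hm])
  have vel': "AE t in lebesgue. velocity_of V (?W t) (u' t)"
    using vel c M
  proof eventually_elim
    fix t assume v: "velocity_of D (\<omega> t) (u t)" and \<omega>c: "\<omega> t \<in> Linf_c D"
      and Mt: "AE x in lebesgue_on D. \<bar>\<omega> t x\<bar> \<le> M"
    obtain \<psi> g where sol: "dirichlet_solution D (\<omega> t) \<psi> g" and ug: "AE x in lebesgue_on D. u t x = perp (g x)"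
      using v unfolding velocity_of_def by blast
    have \<omega>m: "\<omega> t \<in> borel_measurable (lebesgue_on D)" using \<omega>c by (simp add: Linf_c_def)
    define \<psi>' where "\<psi>' x = (if x \<in> D then \<psi> x else - \<psi> (S x))" for x
    define g' where "g' x = (if x \<in> D then g x else - ?R (g (S x)))" for x
    have \<psi>': "\<psi>' x = \<psi> x" "\<psi>' (S x) = - \<psi> x" if "x \<in> D" for x
      using that S_notin_D[OF that] by (auto simp: \<psi>'_def P.S_S)
    have g': "g' x = g x" "g' (S x) = - ?R (g x)" if "x \<in> D" for x
      using that S_notin_D[OF that] by (auto simp: g'_def P.S_S)
    have "dirichlet_solution V (?W t) \<psi>' g'"
      by (rule dirichlet_solution_reflected[OF P.mirror_domain_axioms P_U[unfolded P.U_def] r sol \<omega>m Mt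
            _ _ \<psi>' g']) (simp_all add: odd_extension_upper odd_extension_lower)
    moreover have "AE x in lebesgue_on V. u' t x = perp (g' x)"
    proof (rule AE_VI[OF ug])
      fix x assume x: "x \<in> D" and eq: "u t x = perp (g x)"
      have "perp (- ?R (g x)) = ?R (perp (g x))"
        by (simp add: perp_minus perp_mirror[OF unit])
      then show "u' t x = perp (g' x) \<and> u' t (S x) = perp (g' (S x))"
        using x eq by (simp add: u'1 u'2 g')
    qed
    ultimately show "velocity_of V (?W t) (u' t)" unfolding velocity_of_def by blast
  qed
  \<comment> \<open>From \<open>norm u = norm g \<le> 1 + (norm g)\<^sup>2\<close> the integrand is
    at most \<open>M * (2 + (norm g)\<^sup>2)\<close>; integrating and inserting the energy bound
    gives \<open>C\<close>, which does not depend on time.\<close>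
  define C where "C = M * (2 * measure lebesgue D + (1 + 4 * r\<^sup>2 * M\<^sup>2 * measure lebesgue D))"
  have u_bound: "AE t in lebesgue. (\<integral>\<^sup>+x. ennreal (M * (1 + norm (u t x))) \<partial>lebesgue_on D) \<le> ennreal C"
    using vel c M
  proof eventually_elim
    fix t assume v: "velocity_of D (\<omega> t) (u t)" and \<omega>c: "\<omega> t \<in> Linf_c D"
      and Mt: "AE x in lebesgue_on D. \<bar>\<omega> t x\<bar> \<le> M"
    obtain \<psi> g where sol: "dirichlet_solution D (\<omega> t) \<psi> g" and ug: "AE x in lebesgue_on D. u t x = perp (g x)"
      using v unfolding velocity_of_def by blast
    have \<omega>m: "\<omega> t \<in> borel_measurable (lebesgue_on D)" using \<omega>c by (simp add: Linf_c_def)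
    note en = dirichlet_energy_bound[OF sol open_D r \<omega>m Mt]
    have gm: "g \<in> borel_measurable (lebesgue_on D)" using sol by (simp add: dirichlet_solution_def H10_def)
    have const: "integrable (lebesgue_on D) (\<lambda>x. k)" for k :: real
      by (rule norm_sq_integrable_imp_set_integrable(1)[OF open_D bounded_D gm en(1)])
    have i: "integrable (lebesgue_on D) (\<lambda>x. M * (2 + (norm (g x))\<^sup>2))"
      using const en(1) by simp
    have "(\<integral>\<^sup>+x. ennreal (M * (1 + norm (u t x))) \<partial>lebesgue_on D) \<le>
        (\<integral>\<^sup>+x. ennreal (M * (2 + (norm (g x))\<^sup>2)) \<partial>lebesgue_on D)"
    proof (rule nn_integral_mono_AE, use ug in eventually_elim)
      fix x assume eq: "u t x = perp (g x)"
      have "norm (u t x) = norm (g x)"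
        unfolding eq by (simp add: norm_eq_sqrt_inner perp_def inner_vec_def sum_2 add.commute)
      moreover have "norm (g x) \<le> 1 + (norm (g x))\<^sup>2"
        using zero_le_power2[of "norm (g x) - 1 / 2"] by (simp add: power2_diff power2_eq_square algebra_simps)
      ultimately show "ennreal (M * (1 + norm (u t x))) \<le> ennreal (M * (2 + (norm (g x))\<^sup>2))"
        by (intro ennreal_leI mult_left_mono) (auto simp: M_def)
    qed
    also have "\<dots> = ennreal (LINT x|lebesgue_on D. M * (2 + (norm (g x))\<^sup>2))"
      by (rule nn_integral_eq_integral[OF i]) (simp add: M_def)
    also have "(LINT x|lebesgue_on D. M * (2 + (norm (g x))\<^sup>2)) =
        M * (2 * measure lebesgue D + (LINT x|lebesgue_on D. (norm (g x))\<^sup>2))"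
      using const en(1) D_leb by (simp add: measure_restrict_space)
    also have "\<dots> \<le> C"
      unfolding C_def using en(2) by (intro mult_left_mono add_left_mono) (auto simp: M_def)
    finally show "(\<integral>\<^sup>+x. ennreal (M * (1 + norm (u t x))) \<partial>lebesgue_on D) \<le> ennreal C"
      by (simp add: ennreal_leI)
  qed
  define F where "F = (\<lambda>(t, x). (\<omega> t x, \<omega> t x *\<^sub>R u t x))"
  define F' where "F' = (\<lambda>(t, x). (?W t x, ?W t x *\<^sub>R u' t x))"
  have Fi: "set_integrable lebesgue (T.U \<inter> cball 0 \<rho>) F" for \<rho>
    unfolding T_U F_def by (rule set_integrable_spacetime[OF open_D m um M u_bound])
  have fi: "set_integrable lebesgue (T.U \<inter> cball 0 \<rho>) (\<lambda>p. 0 :: real)" for \<rho>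
    by (simp add: set_integrable_def)
  have W: "(LINT p|lebesgue_on T.U. frechet_derivative \<eta> (at p) (F p) + 0 * \<eta> p) = 0"
    if "\<eta> \<in> test_functions T.U" for \<eta>
  proof -
    have "frechet_derivative \<eta> (at p) (F p) + 0 * \<eta> p = (case p of (t, x) \<Rightarrow>
        \<omega> t x * (deriv (\<lambda>s. \<eta> (s, x)) t + u t x \<bullet> grad (\<lambda>y. \<eta> (t, y)) x))" for p
      using spacetime_pairing[OF that] by (cases p) (simp add: F_def)
    then show ?thesis using weak[of \<eta>] that by (simp add: T_U)
  qed
  \<comment> \<open>In the spatial component the minus sign comes from the vorticity; the time
    component, untouched by the mirror, carries the same sign.\<close>
  have F1: "F' p = F p" and F2: "F' (mirror (0, n) c p) = - mirror (0, n) 0 (F p)" if "p \<in> T.U" for p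
  proof -
    obtain t x where p: "p = (t, x)" by (cases p)
    have x: "x \<in> D" using that by (simp add: p T_U)
    show "F' p = F p" using x by (simp add: p F_def F'_def odd_extension_upper u'1)
    show "F' (mirror (0, n) c p) = - mirror (0, n) 0 (F p)"
      using x by (simp add: p F_def F'_def mirror_time odd_extension_lower u'2 linear_scale[OF linear_mirror])
  qed
  have "(LINT (t, x)|lebesgue_on (UNIV \<times> V).
      ?W t x * (deriv (\<lambda>s. \<phi> (s, x)) t + u' t x \<bullet> grad (\<lambda>y. \<phi> (t, y)) x)) = 0"
    if \<phi>: "\<phi> \<in> test_functions (UNIV \<times> V)" for \<phi>
  proof -
    have "frechet_derivative \<phi> (at p) (F' p) + 0 * \<phi> p = (case p of (t, x) \<Rightarrow>
        ?W t x * (deriv (\<lambda>s. \<phi> (s, x)) t + u' t x \<bullet> grad (\<lambda>y. \<phi> (t, y)) x))" for p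
      using spacetime_pairing[OF \<phi>] by (cases p) (simp add: F'_def)
    moreover have "(LINT p|lebesgue_on (UNIV \<times> V). frechet_derivative \<phi> (at p) (F' p) + 0 * \<phi> p) = 0"
      by (rule T.weak_identity_reflected(3)[where F = F and f = "\<lambda>p. 0", OF Fi fi W F1 F2 _ _ \<phi>]) auto
    ultimately show ?thesis by simp
  qed
  then show ?thesis
    unfolding global_weak_euler_def using odd_extension_Linf_Linf_c[OF \<omega>] u'm vel' by blast
qed

lemma vortex_patch_odd_extension:
  assumes "vortex_patch D \<omega>"
  shows "counter_rotating_pair V (odd_extension D z w \<omega>)"
proof -
  let ?W = "odd_extension D z w \<omega>"
  obtain k A where eu: "global_weak_euler D \<omega>" and A: "\<And>t. A t \<subseteq> D"
    and eq: "AE t in lebesgue. AE x in lebesgue_on D. \<omega> t x = k * indicator (A t) x"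
    using assms unfolding vortex_patch_def by blast
  have sub: "A t \<subseteq> V" "S ` A t \<subseteq> V" for t
    using A[of t] D_subset_V S_D_subset_V by auto
  then have bd: "bounded (A t)" "bounded (S ` A t)" for t
    using bounded_subset[OF bounded_V] by auto
  have "AE t in lebesgue. AE x in lebesgue_on V. ?W t x = k * indicator (A t) x - k * indicator (S ` A t) x"
    using eq
  proof eventually_elim
    fix t assume "AE x in lebesgue_on D. \<omega> t x = k * indicator (A t) x"
    then show "AE x in lebesgue_on V. ?W t x = k * indicator (A t) x - k * indicator (S ` A t) x"
    proof (rule AE_VI)
      fix x assume x: "x \<in> D" and eq: "\<omega> t x = k * indicator (A t) x"
      have 1: "S x \<notin> A t" using S_notin_D[OF x] A by blast
      then have 2: "x \<notin> S ` A t" using mirror_image[OF unit, of x c "A t"] by blast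
      show "?W t x = k * indicator (A t) x - k * indicator (S ` A t) x \<and>
          ?W t (S x) = k * indicator (A t) (S x) - k * indicator (S ` A t) (S x)"
        using x eq 1 2 by (simp add: odd_extension_upper odd_extension_lower indicator_def S_mem_S_D)
    qed
  qed
  then show ?thesis
    unfolding counter_rotating_pair_def using euler_odd_extension[OF eu] sub bd
    by (intro conjI exI[of _ k] exI[of _ A] exI[of _ "\<lambda>t. S ` A t"]) auto
qed

end

theorem proposition1p6:
  fixes D :: "plane set" and z w :: plane and \<omega> :: "real \<Rightarrow> plane \<Rightarrow> real"
  assumes "open D" and "connected D" and "bounded D" and "simply_connected D"
    and "interior (closure D) = D"
    and "z \<noteq> w"
    and "closed_segment z w \<subseteq> frontier D"
    and "frontier D \<inter> affine hull {z, w} = closed_segment z w"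
    and "\<omega> \<in> Linf_Linf_c D"
    and "global_weak_euler D \<omega>"
  shows "odd_extension D z w \<omega> \<in> Linf_Linf_c (doubled_domain D z w)
    \<and> global_weak_euler (doubled_domain D z w) (odd_extension D z w \<omega>)
    \<and> (vortex_patch D \<omega> \<and> time_periodic D \<omega> \<longrightarrow>
        counter_rotating_pair (doubled_domain D z w) (odd_extension D z w \<omega>)
        \<and> time_periodic (doubled_domain D z w) (odd_extension D z w \<omega>))"
proof -
  \<comment> \<open>Here the hypotheses on the segment are turned into a normal direction with
    \<open>D\<close> strictly on its positive side.\<close>
  obtain n c where "n \<bullet> n = 1" "reflect z w = mirror n c" "\<And>x. x \<in> D \<Longrightarrow> c < x \<bullet> n"
    by (fact domain_one_sided[OF assms(1,2,3,6,7,8)])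
  then interpret doubled_plane D z w n c
    by unfold_locales (use assms in auto)
  show ?thesis
    using odd_extension_Linf_Linf_c[OF assms(9)] euler_odd_extension[OF assms(10)]
      vortex_patch_odd_extension time_periodic_odd_extension by blast
qed

end
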